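(* Let $H$ be a separable real Hilbert space, $U\subset H$ a closed subspace, and $Q\in L(H)$ a nonnegative self-adjoint nuclear operator such that $U$ and $U^\perp$ are $Q$-invariant. Consider the statistical model $(\mathbb{P}_\vartheta)_{\vartheta\in\Theta}$ on $H$ with $\Theta=U\times(0,\infty)$ and $\mathbb{P}_\vartheta=\mathrm{N}(\zeta,\sigma^2Q)$ for $\vartheta=(\zeta,\sigma)$, with observation $Y$. Let $U_0\subset U$ be a closed subspace with $U_0\neq\{0\}$ and $U_0\neq U$ such that $U_0$ and $U_0^\perp\cap U$ are $Q$-invariant. Assume that $Q(\Pi_H-\Pi_U)\neq0$ and $Q(\Pi_U-\Pi_{U_0})\neq0$, and that the range of $Q(\Pi_U-\Pi_{U_0})$ is finite dimensional. Set $$\lambda:=\|Q(\Pi_H-\Pi_U)\|,\qquad \mu:=\|Q(\Pi_U-\Pi_{U_0})\|,$$ $$n:=\dim\ker(\lambda-Q(\Pi_H-\Pi_U)),\qquad m:=\dim\operatorname{ran}(Q(\Pi_U-\Pi_{U_0})).$$ Then for each $\alpha\in(0,1)$ the statistical test $$\delta(Y):=\mathbf{1}\bigg\{\frac{n\lambda}{m\mu}\,\frac{\|\Pi_U(Y)-\Pi_{U_0}(Y)\|^2}{\|\Pi_H(Y)-\Pi_U(Y)\|^2}\ge \mathrm{F}_{m,n,1-\alpha}\bigg\}$$ for the test problem $$H_0:\{\zeta\in U_0\}\quad\text{versus}\quad H_1:\{\zeta\notin U_0\}$$ has level of significance $\alpha$.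
   Context: A subspace $V$ is $Q$-invariant if $Q(V)\subset V$. $\Pi_V$ is the orthogonal projection onto a closed subspace $V$; $\Pi_H$ is the identity, and $\lambda-Q(\Pi_H-\Pi_U)$ means $\lambda\Pi_H-Q(\Pi_H-\Pi_U)$. $\mathrm{N}(\zeta,\sigma^2Q)$ is the Gaussian measure on $H$ with mean $\zeta$ and covariance operator $\sigma^2Q$, i.e. if $Y$ has this law then $\langle b,Y\rangle\sim\mathrm{N}(\langle b,\zeta\rangle,\sigma^2\langle Qb,b\rangle)$ (possibly degenerate) for all $b\in H$. $Y$ is the observation (the identity map on $H$), so $Y\sim\mathrm{N}(\zeta,\sigma^2Q)$ under $\mathbb{P}_\vartheta$, and $\mathbb{E}_\vartheta$ is expectation under $\mathbb{P}_\vartheta$. For $a\in(0,1)$, $\mathrm{F}_{m,n,a}$ is the $a$-quantile of the Fisher distribution $\mathrm{F}_{m,n}$ with $m$ and $n$ degrees of freedom. $\mathbf{1}$ denotes the indicator; the quotient may be given any fixed value where its denominator vanishes. The test $\delta(Y)$ has level of significance $\alpha$ if $\mathbb{E}_\vartheta[\delta(Y)]\le\alpha$ for all $\vartheta\in\Theta_0:=U_0\times(0,\infty)$. *)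

theory Defs
  imports "HOL-Probability.Probability"
begin

section \<open>Operators on a real Hilbert space\<close>

text \<open>
  A separable real Hilbert space is a type of sort \<open>{real_inner, polish_space}\<close>: an inner
  product space whose metric is complete and whose topology is second countable, which for a
  metric space is the same as being separable. The dimension of the space may be finite or infinite.
\<close>

definition invariant_under :: "('a \<Rightarrow> 'a) \<Rightarrow> 'a set \<Rightarrow> bool"
  where "invariant_under T V \<longleftrightarrow> T ` V \<subseteq> V"

definition self_adjoint :: "('a::real_inner \<Rightarrow> 'a) \<Rightarrow> bool"
  where "self_adjoint T \<longleftrightarrow> (\<forall>x y. T x \<bullet> y = x \<bullet> T y)"

definition nonneg_operator :: "('a::real_inner \<Rightarrow> 'a) \<Rightarrow> bool"
  where "nonneg_operator T \<longleftrightarrow> (\<forall>x. 0 \<le> T x \<bullet> x)"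

definition nuclear :: "('a::real_inner \<Rightarrow> 'a) \<Rightarrow> bool"
  where "nuclear T \<longleftrightarrow> (\<exists>(a :: nat \<Rightarrow> 'a) (b :: nat \<Rightarrow> 'a).
    summable (\<lambda>j. norm (a j) * norm (b j)) \<and> (\<forall>x. (\<lambda>j. (a j \<bullet> x) *\<^sub>R b j) sums T x))"

text \<open>For a closed subspace of a Hilbert space the described element exists and is unique.\<close>

definition orth_proj :: "'a::real_inner set \<Rightarrow> 'a \<Rightarrow> 'a"
  where "orth_proj V x = (THE p. p \<in> V \<and> x - p \<in> V\<^sup>\<bottom>)"

definition finite_dimensional :: "'a::real_vector set \<Rightarrow> bool"
  where "finite_dimensional V \<longleftrightarrow> (\<exists>B. finite B \<and> V \<subseteq> span B)"


section \<open>Gaussian measures\<close>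

definition normal_law :: "real \<Rightarrow> real \<Rightarrow> real measure"
  where "normal_law \<mu> v =
    (if v = 0 then return borel \<mu> else density lborel (normal_density \<mu> (sqrt v)))"

definition gaussian_measure :: "'a::real_inner measure \<Rightarrow> 'a \<Rightarrow> ('a \<Rightarrow> 'a) \<Rightarrow> bool"
  where "gaussian_measure M \<zeta> C \<longleftrightarrow> prob_space M \<and> sets M = sets borel \<and>
    (\<forall>b. distr M borel (\<lambda>y. b \<bullet> y) = normal_law (b \<bullet> \<zeta>) (C b \<bullet> b))"


section \<open>The Fisher distribution and its quantiles\<close>

text \<open>The law of the sum of the squares of \<open>k\<close> independent standard normal variables.\<close>

definition chi_squared :: "nat \<Rightarrow> real measure"
  where "chi_squared k =
    distr (\<Pi>\<^sub>M i\<in>{..<k}. normal_law 0 1) borel (\<lambda>x. \<Sum>i<k. (x i)\<^sup>2)"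

definition fisher :: "nat \<Rightarrow> nat \<Rightarrow> real measure"
  where "fisher m n =
    distr (chi_squared m \<Otimes>\<^sub>M chi_squared n) borel (\<lambda>(u, v). (u / real m) / (v / real n))"

definition quantile :: "real measure \<Rightarrow> real \<Rightarrow> real"
  where "quantile M a = Inf {x. a \<le> cdf M x}"


section \<open>Statistical tests\<close>

text \<open>
  Measurability is part of the notion of a test; it also ensures that the Bochner
  integral below is the genuine expectation and not a default value.
\<close>

definition statistical_test :: "('a::topological_space \<Rightarrow> real) \<Rightarrow> bool"
  where "statistical_test \<delta> \<longleftrightarrow> \<delta> \<in> borel_measurable borel \<and> (\<forall>y. 0 \<le> \<delta> y \<and> \<delta> y \<le> 1)"

definition level_of_significance ::
    "('p \<Rightarrow> 'a::topological_space measure) \<Rightarrow> 'p set \<Rightarrow> ('a \<Rightarrow> real) \<Rightarrow> real \<Rightarrow> bool"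
  where "level_of_significance P \<Theta>\<^sub>0 \<delta> \<alpha> \<longleftrightarrow>
    statistical_test \<delta> \<and> (\<forall>\<theta>\<in>\<Theta>\<^sub>0. (\<integral>y. \<delta> y \<partial>P \<theta>) \<le> \<alpha>)"

text \<open>
  The value \<open>c\<close> of the quotient where the denominator vanishes is a free parameter.
\<close>

definition quotient_or :: "real \<Rightarrow> real \<Rightarrow> real \<Rightarrow> real"
  where "quotient_or c u v = (if v = 0 then c else u / v)"

end

theory Submission
  imports Defs
begin

text \<open>
  Let \<open>W\<close> be the orthogonal complement of \<open>U\<^sub>0\<close> in \<open>U\<close>. Under the hypothesis the mean \<open>\<zeta>\<close> lies in \<open>U\<^sub>0\<close>, so
  it contributes neither to the numerator, the squared norm of the projection of \<open>Y\<close> onto \<open>W\<close>, nor to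
  the denominator, the squared norm of its projection onto the orthogonal complement of \<open>U\<close>. The
  test statistic is almost surely at most a variable with the Fisher law, because the numerator has an
  upper and the denominator a lower bound in terms of independent normal variables.

  Numerator: choose \<open>g 0, \<dots>, g (m - 1)\<close> in \<open>W\<close> with \<open>Q (g i) \<bullet> g j = \<delta>\<close> and with the vectors \<open>Q (g i)\<close>
  spanning the range of \<open>Q\<close> on \<open>W\<close> (\<open>finite_rank_form_orthonormal_basis\<close>). Almost surely the
  projection of \<open>Y\<close> onto \<open>W\<close> is \<open>Q v\<close> with \<open>v\<close> the sum of the \<open>(g i \<bullet> Y) g i\<close>, and
  \<open>\<parallel>Q v\<parallel>\<^sup>2 \<le> \<mu> (Q v \<bullet> v)\<close> is \<open>\<mu>\<close> times the sum of the squares of the \<open>g i \<bullet> Y\<close> (\<open>nonneg_operator_norm_le\<close>).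

  Denominator: by Bessel's inequality it is at least the sum of the squares of the \<open>f j \<bullet> Y\<close> over an
  orthonormal basis \<open>f\<close> of the eigenspace for \<open>\<lambda>\<close>. Nuclearity makes this eigenspace finite dimensional
  (\<open>nuclear_eigenspace_orthonormal_basis\<close>) and, through compactness, nonzero
  (\<open>onorm_attained_as_eigenvalue\<close>).

  The functionals \<open>g i\<close> and \<open>f j / \<surd>\<lambda>\<close> are together \<open>Q\<close>-orthonormal, so the coordinates of \<open>Y\<close> along
  them, divided by \<open>\<sigma>\<close>, form a standard Gaussian family: every linear combination has the normal law
  with the expected variance. That such a family is independent is derived from uniqueness of
  characteristic functions on the real line (\<open>indep_of_char_factorizes\<close>) by conditioning on one
  coordinate after the other (\<open>standard_gaussian_family_measure\<close>). So the normalised quotient of the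
  two sums of squares has the Fisher law, which has no atoms, and therefore exceeds or equals its
  quantile with probability at most \<open>\<alpha>\<close> (\<open>fisher_quantile_tail\<close>).
\<close>

section \<open>Orthogonal projections onto closed subspaces\<close>

text \<open>
  The minimum over \<open>t\<close> of the quadratic \<open>\<parallel>z - t y\<parallel>\<^sup>2\<close> lies at \<open>t = (z \<bullet> y) / (y \<bullet> y)\<close> and is smaller than
  \<open>\<parallel>z\<parallel>\<^sup>2\<close> by \<open>(z \<bullet> y)\<^sup>2 / (y \<bullet> y)\<close>.
\<close>
lemma minimal_norm_imp_orthogonal:
  fixes z y :: "'a::real_inner"
  assumes "\<And>t. (norm z)\<^sup>2 \<le> (norm (z - t *\<^sub>R y))\<^sup>2"
  shows "z \<bullet> y = 0"
proof (cases "y = 0")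
  case False
  define t where "t = (z \<bullet> y) / (y \<bullet> y)"
  have yy: "y \<bullet> y > 0" using False by simp
  have "(norm (z - t *\<^sub>R y))\<^sup>2 = z \<bullet> z - 2 * t * (z \<bullet> y) + t\<^sup>2 * (y \<bullet> y)"
    by (simp only: power2_norm_eq_inner)
      (simp add: inner_diff_left inner_diff_right inner_commute power2_eq_square algebra_simps)
  also have "\<dots> = (norm z)\<^sup>2 - (z \<bullet> y)\<^sup>2 / (y \<bullet> y)"
    using yy by (simp add: t_def dot_square_norm power2_eq_square field_simps)
  finally have "(z \<bullet> y)\<^sup>2 / (y \<bullet> y) \<le> 0" using assms[of t] by simp
  then have "(z \<bullet> y)\<^sup>2 \<le> 0" using yy by (simp add: divide_le_0_iff)
  then show ?thesis by simp
qed simp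

text \<open>
  The projection theorem: the parallelogram law makes a minimising sequence for the distance from
  \<open>x\<close> to \<open>V\<close> a Cauchy sequence, and its limit is a nearest point, hence orthogonal to \<open>V\<close>.
\<close>
lemma orth_proj_exists:
  fixes V :: "'a::{real_inner, complete_space} set"
  assumes V: "subspace V" "closed V"
  shows "\<exists>p\<in>V. x - p \<in> V\<^sup>\<bottom>"
proof -
  define S where "S = (\<lambda>v. (norm (x - v))\<^sup>2) ` V"
  define D where "D = Inf S"
  have bdd: "bdd_below S" by (auto simp: S_def intro!: bdd_belowI[of _ 0])
  have ne: "S \<noteq> {}" using subspace_0[OF V(1)] by (auto simp: S_def)
  have D_le: "D \<le> (norm (x - v))\<^sup>2" if "v \<in> V" for v
    unfolding D_def using that bdd by (intro cInf_lower) (auto simp: S_def)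
  have "\<exists>v\<in>V. (norm (x - v))\<^sup>2 < D + 1 / real (Suc k)" for k
    using cInf_lessD[OF ne, of "D + 1 / real (Suc k)"] by (auto simp: D_def S_def)
  then obtain p where p: "\<And>k. p k \<in> V" "\<And>k. (norm (x - p k))\<^sup>2 < D + 1 / real (Suc k)"
    by metis
  \<comment> \<open>parallelogram law, applied to the midpoint of two members of the minimising sequence\<close>
  have close: "(norm (p k - p l))\<^sup>2 \<le> 2 / real (Suc k) + 2 / real (Suc l)" for k l
  proof -
    have "(1/2) *\<^sub>R (p k + p l) \<in> V" using p V(1) by (simp add: subspace_add subspace_scale)
    from D_le[OF this] have "4 * D \<le> 4 * (norm (x - (1/2) *\<^sub>R (p k + p l)))\<^sup>2" by simp
    also have "\<dots> = 2 * (norm (x - p k))\<^sup>2 + 2 * (norm (x - p l))\<^sup>2 - (norm (p k - p l))\<^sup>2"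
      by (simp add: power2_norm_eq_inner inner_diff_left inner_diff_right inner_add_left
          inner_add_right inner_commute algebra_simps)
    finally show ?thesis using p(2)[of k] p(2)[of l] by simp
  qed
  have "Cauchy p"
  proof (rule metric_CauchyI)
    fix e :: real assume e: "0 < e"
    obtain N where N: "1 / real (Suc N) < e\<^sup>2 / 4"
      using e nat_approx_posE[of "e\<^sup>2/4"] by auto
    show "\<exists>M. \<forall>m\<ge>M. \<forall>n\<ge>M. dist (p m) (p n) < e"
    proof (intro exI allI impI)
      fix k l assume "N \<le> k" "N \<le> l"
      then have "1 / real (Suc k) \<le> 1 / real (Suc N)" "1 / real (Suc l) \<le> 1 / real (Suc N)"
        by (auto intro!: divide_left_mono)
      with close[of k l] N have "(norm (p k - p l))\<^sup>2 < e\<^sup>2" by simp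
      then show "dist (p k) (p l) < e" using e by (simp add: dist_norm power_less_imp_less_base)
    qed
  qed
  then obtain q where q: "p \<longlonglongrightarrow> q" using Cauchy_convergent convergent_def by blast
  have qV: "q \<in> V" using V(2) p(1) q closed_sequentially by blast
  have "(\<lambda>k. (norm (x - p k))\<^sup>2) \<longlonglongrightarrow> (norm (x - q))\<^sup>2" by (intro tendsto_intros q)
  moreover have "(\<lambda>k. D + 1 / real (Suc k)) \<longlonglongrightarrow> D + 0"
    using LIMSEQ_inverse_real_of_nat by (intro tendsto_intros) (simp add: inverse_eq_divide)
  ultimately have qD: "(norm (x - q))\<^sup>2 \<le> D + 0"
    by (rule LIMSEQ_le) (use p(2) less_imp_le in blast)
  have "(x - q) \<bullet> y = 0" if "y \<in> V" for y
  proof (rule minimal_norm_imp_orthogonal)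
    fix t
    have "q + t *\<^sub>R y \<in> V" using qV that V(1) by (simp add: subspace_add subspace_scale)
    from D_le[OF this] qD have "(norm (x - q))\<^sup>2 \<le> (norm (x - (q + t *\<^sub>R y)))\<^sup>2" by linarith
    then show "(norm (x - q))\<^sup>2 \<le> (norm (x - q - t *\<^sub>R y))\<^sup>2"
      by (simp only: diff_diff_eq)
  qed
  then show ?thesis using qV by (auto simp: orthogonal_comp_def orthogonal_def inner_commute)
qed

lemma orth_proj_unique:
  assumes "subspace V" "p \<in> V" "x - p \<in> V\<^sup>\<bottom>"
  shows "orth_proj V x = p"
  unfolding orth_proj_def
proof (rule the_equality)
  fix q assume q: "q \<in> V \<and> x - q \<in> V\<^sup>\<bottom>"
  have "q - p \<in> V" using q assms by (simp add: subspace_diff)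
  with q assms have "(q - p) \<bullet> (x - p) = 0" "(q - p) \<bullet> (x - q) = 0"
    by (auto simp: orthogonal_comp_def orthogonal_def)
  then have "(q - p) \<bullet> (q - p) = 0" by (simp add: inner_diff_right)
  then show "q = p" by simp
qed (use assms in simp)

context
  fixes V :: "'a::{real_inner, complete_space} set"
  assumes V: "subspace V" "closed V"
begin

lemma orth_proj_in: "orth_proj V x \<in> V"
  and orth_proj_residual: "v \<in> V \<Longrightarrow> v \<bullet> (x - orth_proj V x) = 0"
proof -
  obtain p where p: "p \<in> V" "x - p \<in> V\<^sup>\<bottom>" using orth_proj_exists[OF V] by blast
  then have "orth_proj V x = p" using V(1) orth_proj_unique by blast
  with p show "orth_proj V x \<in> V" "v \<in> V \<Longrightarrow> v \<bullet> (x - orth_proj V x) = 0"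
    by (auto simp: orthogonal_comp_def orthogonal_def)
qed

lemma inner_orth_proj: "v \<in> V \<Longrightarrow> v \<bullet> orth_proj V x = v \<bullet> x"
  using orth_proj_residual[of v x] by (simp add: inner_diff_right)

lemma orth_proj_eqI: "p \<in> V \<Longrightarrow> (\<And>v. v \<in> V \<Longrightarrow> v \<bullet> (x - p) = 0) \<Longrightarrow> orth_proj V x = p"
  using V(1) by (intro orth_proj_unique) (auto simp: orthogonal_comp_def orthogonal_def)

lemma orth_proj_id: "v \<in> V \<Longrightarrow> orth_proj V v = v"
  by (intro orth_proj_eqI) auto

lemma orth_proj_eq_0: "(\<And>v. v \<in> V \<Longrightarrow> v \<bullet> x = 0) \<Longrightarrow> orth_proj V x = 0"
  using subspace_0[OF V(1)] by (intro orth_proj_eqI) auto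

lemma bounded_linear_orth_proj: "bounded_linear (orth_proj V)"
proof (rule bounded_linear_intro[where K=1])
  fix x y :: 'a and r :: real
  show "orth_proj V (x + y) = orth_proj V x + orth_proj V y"
    using V(1) by (intro orth_proj_eqI)
      (auto simp: orth_proj_in subspace_add inner_diff_right inner_add_right inner_orth_proj)
  show "orth_proj V (r *\<^sub>R x) = r *\<^sub>R orth_proj V x"
    using V(1) by (intro orth_proj_eqI)
      (auto simp: orth_proj_in subspace_scale inner_diff_right inner_orth_proj)
  have "(norm (orth_proj V x))\<^sup>2 = orth_proj V x \<bullet> x"
    by (simp add: power2_norm_eq_inner inner_orth_proj orth_proj_in)
  also have "\<dots> \<le> norm (orth_proj V x) * norm x" by (rule norm_cauchy_schwarz)
  finally show "norm (orth_proj V x) \<le> norm x * 1"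
    by (cases "orth_proj V x = 0") (auto simp: power2_eq_square)
qed

end

section \<open>Orthonormal families for nonnegative self-adjoint operators\<close>

text \<open>
  The usual discriminant argument. If \<open>T y \<bullet> y\<close> vanishes, the quadratic in \<open>t\<close> is affine, and it can
  be nonnegative only if its slope vanishes too.
\<close>
lemma nonneg_operator_Cauchy_Schwarz:
  assumes T: "linear T" "self_adjoint T" "nonneg_operator T"
  shows "(T x \<bullet> y)\<^sup>2 \<le> (T x \<bullet> x) * (T y \<bullet> y)"
proof -
  have sym: "T y \<bullet> x = T x \<bullet> y" using T(2) by (metis self_adjoint_def inner_commute)
  have pos: "0 \<le> T z \<bullet> z" for z using T(3) by (simp add: nonneg_operator_def)
  have quad: "0 \<le> T x \<bullet> x - 2 * t * (T x \<bullet> y) + t\<^sup>2 * (T y \<bullet> y)" for t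
  proof -
    have "0 \<le> T (x - t *\<^sub>R y) \<bullet> (x - t *\<^sub>R y)" by (rule pos)
    also have "\<dots> = T x \<bullet> x - 2 * t * (T x \<bullet> y) + t\<^sup>2 * (T y \<bullet> y)"
      by (simp add: linear_diff[OF T(1)] linear_scale[OF T(1)] inner_diff_left inner_diff_right
          sym power2_eq_square algebra_simps)
    finally show ?thesis .
  qed
  show ?thesis
  proof (cases "T y \<bullet> y = 0")
    case True
    have "T x \<bullet> y = 0"
    proof (rule ccontr)
      assume "T x \<bullet> y \<noteq> 0"
      with quad[of "(T x \<bullet> x + 1) / (2 * (T x \<bullet> y))"] True show False by simp
    qed
    then show ?thesis by (simp add: True)
  next
    case False
    then have "0 < T y \<bullet> y" using pos[of y] by simp
    with quad[of "(T x \<bullet> y) / (T y \<bullet> y)"] show ?thesis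
      by (simp add: power2_eq_square field_simps)
  qed
qed

text \<open>
  Cauchy-Schwarz for the form \<open>(x, y) \<mapsto> T x \<bullet> y\<close>, applied to \<open>x\<close> and \<open>T x\<close>. With \<open>K\<close> the norm of \<open>T\<close>
  on an invariant subspace, this takes the place of comparing every eigenvalue of \<open>T\<close> there with the
  largest one.
\<close>
lemma nonneg_operator_norm_le:
  assumes T: "linear T" "self_adjoint T" "nonneg_operator T"
    and K: "norm (T (T x)) \<le> K * norm (T x)"
  shows "(norm (T x))\<^sup>2 \<le> K * (T x \<bullet> x)"
proof (cases "T x = 0")
  case False
  have nn: "0 \<le> T x \<bullet> x" using T(3) by (simp add: nonneg_operator_def)
  have "((norm (T x))\<^sup>2)\<^sup>2 = (T x \<bullet> T x)\<^sup>2" by (simp add: power2_norm_eq_inner)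
  also have "\<dots> \<le> (T x \<bullet> x) * (T (T x) \<bullet> T x)" by (rule nonneg_operator_Cauchy_Schwarz[OF T])
  also have "\<dots> \<le> (T x \<bullet> x) * (K * norm (T x) * norm (T x))"
    using norm_cauchy_schwarz[of "T (T x)" "T x"] mult_right_mono[OF K, of "norm (T x)"] nn
    by (intro mult_left_mono) auto
  finally have "((norm (T x))\<^sup>2)\<^sup>2 \<le> (T x \<bullet> x) * (K * norm (T x) * norm (T x))" .
  then have "(norm (T x))\<^sup>2 * (norm (T x))\<^sup>2 \<le> K * (T x \<bullet> x) * (norm (T x))\<^sup>2"
    by (simp add: power2_eq_square mult_ac)
  moreover have "0 < (norm (T x))\<^sup>2" using False by simp
  ultimately show ?thesis by (rule mult_right_le_imp_le)
qed (use T(3) in simp)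

text \<open>
  Orthonormality for the possibly degenerate form \<open>(x, y) \<mapsto> T x \<bullet> y\<close>; the identity for \<open>T\<close> gives
  orthonormal families in the usual sense.
\<close>
definition form_orthonormal :: "('a::real_inner \<Rightarrow> 'a) \<Rightarrow> nat \<Rightarrow> (nat \<Rightarrow> 'a) \<Rightarrow> bool"
  where "form_orthonormal T k g \<longleftrightarrow> (\<forall>i<k. \<forall>j<k. T (g i) \<bullet> g j = (if i = j then 1 else 0))"

lemma form_orthonormal_sum:
  assumes T: "linear T" and g: "form_orthonormal T k g"
  shows "T (\<Sum>i<k. t i *\<^sub>R g i) \<bullet> (\<Sum>i<k. t i *\<^sub>R g i) = (\<Sum>i<k. (t i)\<^sup>2)"
proof -
  have "T (\<Sum>i<k. t i *\<^sub>R g i) \<bullet> (\<Sum>i<k. t i *\<^sub>R g i) = (\<Sum>i<k. \<Sum>j<k. t j * (t i * (T (g j) \<bullet> g i)))"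
    by (simp add: linear_sum[OF T] linear_scale[OF T] inner_sum_left inner_sum_right sum_distrib_left mult_ac)
  also have "\<dots> = (\<Sum>i<k. \<Sum>j<k. if j = i then (t i)\<^sup>2 else 0)"
    using g by (intro sum.cong) (auto simp: form_orthonormal_def power2_eq_square)
  finally show ?thesis by simp
qed

lemma biorthogonal_independent:
  fixes u v :: "nat \<Rightarrow> 'a::real_inner"
  assumes uv: "\<And>i j. i < k \<Longrightarrow> j < k \<Longrightarrow> u i \<bullet> v j = (if i = j then 1 else 0)"
  shows "inj_on u {..<k}" "independent (u ` {..<k})"
proof -
  show inj: "inj_on u {..<k}"
  proof (rule inj_onI)
    fix i j assume ij: "i \<in> {..<k}" "j \<in> {..<k}" and eq: "u i = u j"
    have "u j \<bullet> v i = 1" using uv[of i i] ij by (simp flip: eq)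
    then show "i = j" using uv[of j i] ij by (simp split: if_splits)
  qed
  show "independent (u ` {..<k})"
  proof (subst independent_explicit_finite_subsets, intro allI impI ballI)
    fix A c x assume A: "A \<subseteq> u ` {..<k}" "finite A" and s: "(\<Sum>x\<in>A. c x *\<^sub>R x) = 0" and x: "x \<in> A"
    obtain j where j: "j < k" "x = u j" using A x by auto
    have "0 = (\<Sum>x\<in>A. c x *\<^sub>R x) \<bullet> v j" by (simp add: s)
    also have "\<dots> = (\<Sum>y\<in>A. c y * (y \<bullet> v j))" by (simp add: inner_sum_left)
    also have "\<dots> = (\<Sum>y\<in>A. if y = x then c y else 0)"
    proof (rule sum.cong)
      fix y assume "y \<in> A"
      then obtain i where i: "i < k" "y = u i" using A by auto
      then have "y = x \<longleftrightarrow> i = j" using j inj by (auto simp: inj_on_def)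
      then show "c y * (y \<bullet> v j) = (if y = x then c y else 0)" using uv[OF i(1) j(1)] i by simp
    qed simp
    also have "\<dots> = c x" using A x by simp
    finally show "c x = 0" by simp
  qed
qed

text \<open>
  Gram-Schmidt by maximality. If the remainder \<open>r\<close> of some \<open>w\<close> had \<open>T r \<bullet> r > 0\<close>, a multiple of \<open>r\<close>
  could be added to a family of the largest possible size; so \<open>T r \<bullet> r = 0\<close>, which forces \<open>T r = 0\<close>.
\<close>
lemma form_orthonormal_maximal:
  assumes T: "linear T" "self_adjoint T" "nonneg_operator T" and W: "subspace W"
    and bound: "\<And>k g. form_orthonormal T k g \<Longrightarrow> (\<And>i. i < k \<Longrightarrow> g i \<in> W) \<Longrightarrow> k \<le> K"
  obtains k g where "form_orthonormal T k g" "\<And>i. i < k \<Longrightarrow> g i \<in> W"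
    "\<And>w. w \<in> W \<Longrightarrow> T (w - (\<Sum>i<k. (T (g i) \<bullet> w) *\<^sub>R g i)) = 0"
proof -
  define P where "P k \<longleftrightarrow> (\<exists>g. form_orthonormal T k g \<and> (\<forall>i<k. g i \<in> W))" for k
  define k where "k = (GREATEST k. P k)"
  have P0: "P 0" by (simp add: P_def form_orthonormal_def)
  have Pb: "\<And>k. P k \<Longrightarrow> k \<le> K" using bound by (auto simp: P_def)
  have "P k" unfolding k_def by (rule GreatestI_nat[of P, OF P0 Pb])
  then obtain g where g: "form_orthonormal T k g" "\<And>i. i < k \<Longrightarrow> g i \<in> W" by (auto simp: P_def)
  have nP: "\<not> P (Suc k)" using Greatest_le_nat[of P "Suc k" K] Pb k_def by auto
  have sym: "T x \<bullet> y = T y \<bullet> x" for x y using T(2) by (metis self_adjoint_def inner_commute)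
  have "T (w - (\<Sum>i<k. (T (g i) \<bullet> w) *\<^sub>R g i)) = 0" if w: "w \<in> W" for w
  proof -
    define r where "r = w - (\<Sum>i<k. (T (g i) \<bullet> w) *\<^sub>R g i)"
    have rW: "r \<in> W" unfolding r_def using W w g(2)
      by (intro subspace_diff subspace_sum subspace_scale) auto
    have orth: "T (g j) \<bullet> r = 0" if j: "j < k" for j
    proof -
      have "T (g j) \<bullet> r = T (g j) \<bullet> w - (\<Sum>i<k. (T (g i) \<bullet> w) * (T (g j) \<bullet> g i))"
        by (simp add: r_def inner_diff_right inner_sum_right)
      also have "(\<Sum>i<k. (T (g i) \<bullet> w) * (T (g j) \<bullet> g i)) = (\<Sum>i<k. if i = j then T (g i) \<bullet> w else 0)"
        using g(1) j by (intro sum.cong) (auto simp: form_orthonormal_def)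
      finally show ?thesis using j by simp
    qed
    have "T r \<bullet> r = 0"
    proof (rule ccontr)
      assume nz: "T r \<bullet> r \<noteq> 0"
      then have pos: "T r \<bullet> r > 0" using T(3) by (simp add: nonneg_operator_def less_le)
      define s where "s = sqrt (T r \<bullet> r)"
      have s: "s > 0" "s * s = T r \<bullet> r" using pos by (auto simp: s_def)
      define g' where "g' = g(k := (1/s) *\<^sub>R r)"
      have "form_orthonormal T (Suc k) g'"
        unfolding form_orthonormal_def
      proof (intro allI impI)
        fix i j assume "i < Suc k" "j < Suc k"
        then consider "i < k" "j < k" | "i = k" "j < k" | "i < k" "j = k" | "i = k" "j = k"
          by linarith
        then show "T (g' i) \<bullet> g' j = (if i = j then 1 else 0)"
        proof cases
          case 1 then show ?thesis using g(1) by (simp add: form_orthonormal_def g'_def)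
        next
          case 2 then have "T r \<bullet> g j = 0" using orth[of j] sym[of r "g j"] by simp
          then show ?thesis using 2 by (simp add: g'_def linear_scale[OF T(1)])
        next
          case 3 then show ?thesis using orth by (simp add: g'_def)
        next
          case 4 then show ?thesis using s pos by (simp add: g'_def linear_scale[OF T(1)] s(2)[symmetric])
        qed
      qed
      moreover have "\<forall>i<Suc k. g' i \<in> W" using g(2) rW W by (auto simp: g'_def subspace_scale less_Suc_eq)
      ultimately have "P (Suc k)" by (auto simp: P_def)
      with nP show False by simp
    qed
    then have "(T r \<bullet> T r)\<^sup>2 \<le> 0"
      using nonneg_operator_Cauchy_Schwarz[OF T, of r "T r"] by simp
    then show ?thesis by (simp add: r_def)
  qed
  with g show thesis using that by blast
qed

text \<open>
  The images under \<open>T\<close> of a \<open>T\<close>-orthonormal family are biorthogonal to the family itself, hence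
  independent. This bounds the size of such families, and a maximal one has images that span
  \<open>T ` W\<close>.
\<close>
lemma finite_rank_form_orthonormal_basis:
  assumes T: "linear T" "self_adjoint T" "nonneg_operator T" and W: "subspace W"
    and fin: "finite_dimensional (T ` W)"
  obtains g where "form_orthonormal T (dim (T ` W)) g" "\<And>i. i < dim (T ` W) \<Longrightarrow> g i \<in> W"
    "\<And>w. w \<in> W \<Longrightarrow> T (w - (\<Sum>i<dim (T ` W). (T (g i) \<bullet> w) *\<^sub>R g i)) = 0"
proof -
  obtain F where F: "finite F" "T ` W \<subseteq> span F"
    using fin by (auto simp: finite_dimensional_def)
  have ind: "inj_on (\<lambda>i. T (g i)) {..<k}" "independent ((\<lambda>i. T (g i)) ` {..<k})"
    if "form_orthonormal T k g" for k g
    using biorthogonal_independent[of k "\<lambda>i. T (g i)" g] that by (auto simp: form_orthonormal_def)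
  have bound: "k \<le> card F" if g: "form_orthonormal T k g" "\<And>i. i < k \<Longrightarrow> g i \<in> W" for k g
  proof -
    have "(\<lambda>i. T (g i)) ` {..<k} \<subseteq> span F" using g(2) F(2) by blast
    from independent_span_bound[OF F(1) ind(2)[OF g(1)] this]
    show ?thesis by (simp add: card_image[OF ind(1)[OF g(1)]])
  qed
  obtain k g where g: "form_orthonormal T k g" "\<And>i. i < k \<Longrightarrow> g i \<in> W"
    and null: "\<And>w. w \<in> W \<Longrightarrow> T (w - (\<Sum>i<k. (T (g i) \<bullet> w) *\<^sub>R g i)) = 0"
    by (rule form_orthonormal_maximal[OF T W, of "card F"]) (use bound in blast)+
  have "T w \<in> span ((\<lambda>i. T (g i)) ` {..<k})" if "w \<in> W" for w
  proof -
    have "T w = (\<Sum>i<k. (T (g i) \<bullet> w) *\<^sub>R T (g i))"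
      using null[OF that] by (simp add: linear_diff[OF T(1)] linear_sum[OF T(1)] linear_scale[OF T(1)])
    also have "\<dots> \<in> span ((\<lambda>i. T (g i)) ` {..<k})" by (intro span_sum span_scale span_base) auto
    finally show ?thesis .
  qed
  then have "dim (T ` W) = card ((\<lambda>i. T (g i)) ` {..<k})"
    using g(2) ind(2)[OF g(1)] by (intro dim_unique) auto
  then have "dim (T ` W) = k" by (simp add: card_image[OF ind(1)[OF g(1)]])
  with g null show ?thesis using that by blast
qed

section \<open>Nuclear operators\<close>

lemma Bessel_inequality:
  assumes f: "form_orthonormal (\<lambda>x. x) k f"
  shows "(\<Sum>i<k. (f i \<bullet> b)\<^sup>2) \<le> (norm b)\<^sup>2"
proof -
  define p where "p = (\<Sum>i<k. (f i \<bullet> b) *\<^sub>R f i)"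
  have bp: "b \<bullet> p = (\<Sum>i<k. (f i \<bullet> b)\<^sup>2)"
    by (simp add: p_def inner_sum_right power2_eq_square inner_commute)
  have "p \<bullet> p = (\<Sum>i<k. (f i \<bullet> b)\<^sup>2)"
    unfolding p_def by (rule form_orthonormal_sum[OF linear_ident f])
  then have "(b - p) \<bullet> (b - p) = b \<bullet> b - (\<Sum>i<k. (f i \<bullet> b)\<^sup>2)"
    using bp by (simp add: inner_diff_left inner_diff_right inner_commute)
  then show ?thesis using inner_ge_zero[of "b - p"] by (simp add: dot_square_norm)
qed

text \<open>
  In the sum of the terms \<open>(a j \<bullet> f i) * (b j \<bullet> f i)\<close> over \<open>i\<close>, the inequalities of Cauchy-Schwarz and
  Bessel give the bound \<open>\<parallel>a j\<parallel> \<parallel>b j\<parallel>\<close>, which does not depend on the family and is summable over \<open>j\<close>.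
\<close>
lemma nuclear_trace_bounded:
  assumes "nuclear T"
  obtains C where "\<And>k f. form_orthonormal (\<lambda>x. x) k f \<Longrightarrow> (\<Sum>i<k. T (f i) \<bullet> f i) \<le> C"
proof -
  obtain a b where sm: "summable (\<lambda>j::nat. norm (a j) * norm (b j))"
    and T: "\<And>x. (\<lambda>j. (a j \<bullet> x) *\<^sub>R b j) sums T x"
    using assms by (auto simp: nuclear_def)
  have "(\<Sum>i<k. T (f i) \<bullet> f i) \<le> (\<Sum>j. norm (a j) * norm (b j))"
    if f: "form_orthonormal (\<lambda>x. x) k f" for k f
  proof (rule sums_le[OF _ _ summable_sums[OF sm]])
    have "(\<lambda>j. (a j \<bullet> x) * (b j \<bullet> y)) sums (T x \<bullet> y)" for x y
      using bounded_linear.sums[OF bounded_linear_inner_left T[of x], of y] by simp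
    then show "(\<lambda>j. \<Sum>i<k. (a j \<bullet> f i) * (b j \<bullet> f i)) sums (\<Sum>i<k. T (f i) \<bullet> f i)"
      by (intro sums_sum)
    fix j
    have "(\<Sum>i<k. (a j \<bullet> f i) * (b j \<bullet> f i)) \<le> (\<Sum>i<k. \<bar>a j \<bullet> f i\<bar> * \<bar>b j \<bullet> f i\<bar>)"
      by (intro sum_mono) (simp flip: abs_mult)
    also have "\<dots> \<le> L2_set (\<lambda>i. a j \<bullet> f i) {..<k} * L2_set (\<lambda>i. b j \<bullet> f i) {..<k}"
      by (rule L2_set_mult_ineq)
    also have "\<dots> \<le> norm (a j) * norm (b j)"
      using Bessel_inequality[OF f]
      by (intro mult_mono) (auto simp: L2_set_def inner_commute intro!: real_le_lsqrt sum_nonneg)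
    finally show "(\<Sum>i<k. (a j \<bullet> f i) * (b j \<bullet> f i)) \<le> norm (a j) * norm (b j)" .
  qed
  then show ?thesis using that by blast
qed

lemma compact_bounded_combinations:
  fixes b :: "nat \<Rightarrow> 'a::real_normed_vector" and r :: "nat \<Rightarrow> real"
  shows "compact {\<Sum>j<N. c j *\<^sub>R b j |c. \<forall>j<N. \<bar>c j\<bar> \<le> r j}"
proof (induction N)
  case (Suc N)
  let ?C = "\<lambda>N. {\<Sum>j<N. c j *\<^sub>R b j |c. \<forall>j<N. \<bar>c j\<bar> \<le> r j}"
  have "compact ((\<lambda>t. t *\<^sub>R b N) ` {- r N..r N})"
    by (intro compact_continuous_image continuous_intros compact_Icc)
  from compact_sums[OF Suc.IH this]
  have "compact {x + y |x y. x \<in> ?C N \<and> y \<in> (\<lambda>t. t *\<^sub>R b N) ` {- r N..r N}}" .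
  also have "{x + y |x y. x \<in> ?C N \<and> y \<in> (\<lambda>t. t *\<^sub>R b N) ` {- r N..r N}} = ?C (Suc N)"
  proof (intro equalityI subsetI)
    fix z assume "z \<in> {x + y |x y. x \<in> ?C N \<and> y \<in> (\<lambda>t. t *\<^sub>R b N) ` {- r N..r N}}"
    then obtain x t where x: "x \<in> ?C N" "t \<in> {- r N..r N}" "z = x + t *\<^sub>R b N" by blast
    then obtain c where c: "\<forall>j<N. \<bar>c j\<bar> \<le> r j" "x = (\<Sum>j<N. c j *\<^sub>R b j)" by blast
    then have "\<bar>t\<bar> \<le> r N" using x by (simp add: abs_le_iff minus_le_iff)
    with x c show "z \<in> ?C (Suc N)"
      by (intro CollectI exI[of _ "c(N := t)"]) (auto simp: less_Suc_eq)
  next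
    fix z assume "z \<in> ?C (Suc N)"
    then obtain c where c: "\<forall>j<Suc N. \<bar>c j\<bar> \<le> r j" "z = (\<Sum>j<Suc N. c j *\<^sub>R b j)" by auto
    then show "z \<in> {x + y |x y. x \<in> ?C N \<and> y \<in> (\<lambda>t. t *\<^sub>R b N) ` {- r N..r N}}"
      by (intro CollectI exI[of _ "\<Sum>j<N. c j *\<^sub>R b j"] exI[of _ "c N *\<^sub>R b N"])
        (auto simp: abs_le_iff less_Suc_eq neg_le_iff_le minus_le_iff)
  qed
  finally show ?case .
qed auto

text \<open>
  The partial sums of a nuclear representation map the unit ball into compact sets of bounded
  combinations, and the remainder is uniformly small on the unit ball. So the image of the ball is
  totally bounded.
\<close>
lemma nuclear_imp_compact:
  fixes T :: "'a::{real_inner, complete_space} \<Rightarrow> 'a"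
  assumes "nuclear T"
  shows "compact (closure (T ` cball 0 1))"
proof -
  obtain a b where sm: "summable (\<lambda>j::nat. norm (a j) * norm (b j))"
    and T: "\<And>x. (\<lambda>j. (a j \<bullet> x) *\<^sub>R b j) sums T x"
    using assms by (auto simp: nuclear_def)
  show ?thesis
    unfolding compact_eq_totally_bounded
  proof (intro conjI allI impI)
    show "Topological_Spaces.complete (closure (T ` cball 0 1))" by (simp add: complete_eq_closed)
    fix e :: real assume e: "0 < e"
    obtain N where N: "norm (\<Sum>j. norm (a (j + N)) * norm (b (j + N))) < e / 4"
      using suminf_exist_split[OF _ sm, of "e / 4"] e by auto
    define C where "C = {\<Sum>j<N. c j *\<^sub>R b j |c. \<forall>j<N. \<bar>c j\<bar> \<le> norm (a j)}"
    have "compact C" unfolding C_def by (rule compact_bounded_combinations)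
    then obtain F where F: "finite F" "C \<subseteq> (\<Union>x\<in>F. ball x (e / 4))"
      using e unfolding compact_eq_totally_bounded by (meson divide_pos_pos zero_less_numeral)
    have "T ` cball 0 1 \<subseteq> (\<Union>x\<in>F. cball x (e / 2))"
    proof
      fix y assume "y \<in> T ` cball 0 1"
      then obtain x where x: "norm x \<le> 1" "y = T x" by auto
      have le: "norm ((a j \<bullet> x) *\<^sub>R b j) \<le> norm (a j) * norm (b j)" for j
        using Cauchy_Schwarz_ineq2[of "a j" x] x mult_left_mono[of "norm x" 1 "norm (a j)"]
        by (auto intro!: mult_right_mono)
      define h where "h = (\<Sum>j<N. (a j \<bullet> x) *\<^sub>R b j)"
      have "\<bar>a j \<bullet> x\<bar> \<le> norm (a j)" for j
        using Cauchy_Schwarz_ineq2[of "a j" x] mult_left_mono[OF x(1), of "norm (a j)"] by simp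
      then have "h \<in> C" unfolding h_def C_def
        by (intro CollectI exI[of _ "\<lambda>j. a j \<bullet> x"]) auto
      then obtain u where u: "u \<in> F" "dist u h < e / 4" using F by auto
      have smN: "summable (\<lambda>j. norm (a (j + N)) * norm (b (j + N)))"
        using sm by (rule summable_ignore_initial_segment)
      have "(\<lambda>j. (a (j + N) \<bullet> x) *\<^sub>R b (j + N)) sums (T x - h)"
        using sums_split_initial_segment[OF T[of x]] by (simp add: h_def)
      then have "(\<lambda>n. norm (\<Sum>j<n. (a (j + N) \<bullet> x) *\<^sub>R b (j + N))) \<longlonglongrightarrow> norm (T x - h)"
        unfolding sums_def by (rule tendsto_norm)
      moreover have "norm (\<Sum>j<n. (a (j + N) \<bullet> x) *\<^sub>R b (j + N))
          \<le> (\<Sum>j. norm (a (j + N)) * norm (b (j + N)))" for n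
        using smN by (intro order_trans[OF sum_norm_le[OF le] sum_le_suminf]) auto
      ultimately have "norm (T x - h) \<le> (\<Sum>j. norm (a (j + N)) * norm (b (j + N)))"
        by (intro LIMSEQ_le_const2) auto
      then have "norm (T x - h) < e / 4" using N by simp
      with u have "dist u y < e / 2"
        using dist_triangle[of u y h] by (simp add: x dist_norm norm_minus_commute)
      with u show "y \<in> (\<Union>x\<in>F. cball x (e / 2))" by (auto intro: less_imp_le)
    qed
    moreover have "closed (\<Union>x\<in>F. cball x (e / 2))" using F by (intro closed_UN) auto
    ultimately have "closure (T ` cball 0 1) \<subseteq> (\<Union>x\<in>F. cball x (e / 2))" by (rule closure_minimal)
    also have "\<dots> \<subseteq> (\<Union>x\<in>F. ball x e)" using e by (intro UN_mono) auto
    finally show "\<exists>F. finite F \<and> closure (T ` cball 0 1) \<subseteq> (\<Union>x\<in>F. ball x e)" using F by blast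
  qed
qed

text \<open>
  Let \<open>x k\<close> lie in the unit ball, with \<open>\<parallel>T (x k)\<parallel>\<close> tending to \<open>L = onorm T\<close>, and \<open>y\<close> the limit
  of a subsequence of \<open>T (x k)\<close>. Self-adjointness gives
  \<open>\<parallel>T (T u) - L\<^sup>2 u\<parallel>\<^sup>2 \<le> L\<^sup>2 (L\<^sup>2 - \<parallel>T u\<parallel>\<^sup>2)\<close> for \<open>u\<close> in the unit ball, so that \<open>T (T y) = L\<^sup>2 y\<close>.
  Then \<open>z = T y + L y\<close> satisfies \<open>T z = L z\<close>, and \<open>z \<bullet> y \<ge> L \<parallel>y\<parallel>\<^sup>2 > 0\<close> because \<open>T\<close> is nonnegative.
\<close>
lemma onorm_attained_as_eigenvalue:
  assumes T: "bounded_linear T" "self_adjoint T" "nonneg_operator T"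
    and S: "T ` cball 0 1 \<subseteq> S" "compact S" and nz: "T \<noteq> (\<lambda>x. 0)"
  obtains z where "z \<noteq> 0" "T z = onorm T *\<^sub>R z"
proof -
  interpret T: bounded_linear T by fact
  define L where "L = onorm T"
  have L: "L > 0" using onorm_pos_lt[OF T(1)] nz by (auto simp: L_def)
  have le: "norm (T x) \<le> L * norm x" for x unfolding L_def by (rule onorm[OF T(1)])
  have "\<exists>x. norm x \<le> 1 \<and> L - 1 / Suc k < norm (T x)" for k
  proof (rule ccontr)
    assume "\<not> ?thesis"
    then have *: "norm x \<le> 1 \<Longrightarrow> norm (T x) \<le> L - 1 / Suc k" for x by (meson not_less)
    have "norm (T x) \<le> (L - 1 / Suc k) * norm x" for x
    proof (cases "x = 0")
      case False
      with *[of "x /\<^sub>R norm x"] show ?thesis by (simp add: T.scaleR field_simps)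
    qed simp
    then have "L \<le> L - 1 / Suc k"
      using *[of 0] onorm_bound[of "L - 1 / Suc k" T] by (simp add: L_def)
    then show False by simp
  qed
  then obtain x where x: "\<And>k. norm (x k) \<le> 1" "\<And>k. L - 1 / Suc k < norm (T (x k))" by metis
  have "\<forall>k. T (x k) \<in> S" using S(1) x(1) by auto
  then obtain y r where r: "strict_mono r" and y: "(\<lambda>k. T (x (r k))) \<longlonglongrightarrow> y"
    using S(2) unfolding compact_def by (fastforce simp: o_def)
  have "(\<lambda>k. norm (T (x k))) \<longlonglongrightarrow> L"
  proof (rule tendsto_sandwich)
    show "(\<lambda>k. L - 1 / Suc k) \<longlonglongrightarrow> L"
      using tendsto_diff[OF tendsto_const LIMSEQ_inverse_real_of_nat, of L]
      by (simp add: inverse_eq_divide)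
    show "\<forall>\<^sub>F k in sequentially. norm (T (x k)) \<le> L"
      using le x(1) L by (intro always_eventually allI) (meson mult_left_le order_trans less_imp_le)
  qed (use x(2) in \<open>auto intro!: always_eventually less_imp_le\<close>)
  then have nT: "(\<lambda>k. norm (T (x (r k)))) \<longlonglongrightarrow> L" using LIMSEQ_subseq_LIMSEQ[OF _ r] by (auto simp: o_def)
  with tendsto_norm[OF y] have ny: "norm y = L" by (rule LIMSEQ_unique)
  have "(norm (T (T u) - L\<^sup>2 *\<^sub>R u))\<^sup>2 \<le> L\<^sup>2 * (L\<^sup>2 - (norm (T u))\<^sup>2)" if u: "norm u \<le> 1" for u
  proof -
    have sa: "T (T u) \<bullet> u = T u \<bullet> T u" using T(2) by (simp add: self_adjoint_def)
    have "(norm (T (T u) - L\<^sup>2 *\<^sub>R u))\<^sup>2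
        = (norm (T (T u)))\<^sup>2 - 2 * L\<^sup>2 * (norm (T u))\<^sup>2 + L\<^sup>2 * L\<^sup>2 * (norm u)\<^sup>2"
      by (simp only: power2_norm_eq_inner)
        (simp add: inner_diff_left inner_diff_right inner_commute sa[unfolded inner_commute[of _ u]] algebra_simps)
    also have "\<dots> \<le> (L * norm (T u))\<^sup>2 - 2 * L\<^sup>2 * (norm (T u))\<^sup>2 + L\<^sup>2 * L\<^sup>2 * 1"
      using le[of "T u"] u by (intro add_mono diff_mono power_mono mult_left_mono) (auto simp: power_le_one)
    finally show ?thesis by (simp add: power_mult_distrib algebra_simps)
  qed
  then have bnd: "(norm (T (T (x (r k))) - L\<^sup>2 *\<^sub>R x (r k)))\<^sup>2 \<le> L\<^sup>2 * (L\<^sup>2 - (norm (T (x (r k))))\<^sup>2)" for k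
    using x(1) by simp
  have "(\<lambda>k. (norm (T (T (x (r k))) - L\<^sup>2 *\<^sub>R x (r k)))\<^sup>2) \<longlonglongrightarrow> 0"
  proof (rule tendsto_sandwich[where f = "\<lambda>_. 0"])
    have "(\<lambda>k. L\<^sup>2 * (L\<^sup>2 - (norm (T (x (r k))))\<^sup>2)) \<longlonglongrightarrow> L\<^sup>2 * (L\<^sup>2 - L\<^sup>2)" by (intro tendsto_intros nT)
    then show "(\<lambda>k. L\<^sup>2 * (L\<^sup>2 - (norm (T (x (r k))))\<^sup>2)) \<longlonglongrightarrow> 0" by simp
  qed (use bnd in \<open>auto intro!: always_eventually\<close>)
  from tendsto_real_sqrt[OF this] have "(\<lambda>k. T (T (x (r k))) - L\<^sup>2 *\<^sub>R x (r k)) \<longlonglongrightarrow> 0"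
    by (simp add: tendsto_norm_zero_iff)
  from tendsto_diff[OF T.tendsto[OF y] this] have "(\<lambda>k. L\<^sup>2 *\<^sub>R x (r k)) \<longlonglongrightarrow> T y" by simp
  from T.tendsto[OF this] have "(\<lambda>k. L\<^sup>2 *\<^sub>R T (x (r k))) \<longlonglongrightarrow> T (T y)" by (simp add: T.scaleR)
  moreover have "(\<lambda>k. L\<^sup>2 *\<^sub>R T (x (r k))) \<longlonglongrightarrow> L\<^sup>2 *\<^sub>R y" by (intro tendsto_intros y)
  ultimately have TTy: "T (T y) = L\<^sup>2 *\<^sub>R y" by (rule LIMSEQ_unique)
  define z where "z = T y + L *\<^sub>R y"
  have "T z = L *\<^sub>R z"
    by (simp add: z_def T.add T.scaleR TTy scaleR_add_right power2_eq_square)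
  moreover have "z \<noteq> 0"
  proof
    assume "z = 0"
    then have "0 = T y \<bullet> y + L * (y \<bullet> y)" by (metis z_def inner_add_left inner_scaleR_left inner_zero_left)
    moreover have "L * (y \<bullet> y) > 0" using L ny by auto
    moreover have "T y \<bullet> y \<ge> 0" using T(3) by (simp add: nonneg_operator_def)
    ultimately show False by linarith
  qed
  ultimately show ?thesis using that by (simp add: L_def)
qed

text \<open>
  An orthonormal family of \<open>k\<close> vectors in \<open>E\<close> contributes \<open>k * lam\<close> to the trace, so nuclearity bounds
  its size, and a maximal family is a basis.
\<close>
lemma nuclear_eigenspace_orthonormal_basis:
  assumes T: "nuclear T" and E: "subspace E"
    and eigen: "\<And>x. x \<in> E \<Longrightarrow> T x = lam *\<^sub>R x" and lam: "0 < lam"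
  obtains f where "form_orthonormal (\<lambda>x. x) (dim E) f" "\<And>i. i < dim E \<Longrightarrow> f i \<in> E"
    "\<And>w. w \<in> E \<Longrightarrow> w = (\<Sum>i<dim E. (f i \<bullet> w) *\<^sub>R f i)"
proof -
  obtain C where C: "\<And>k f. form_orthonormal (\<lambda>x. x) k f \<Longrightarrow> (\<Sum>i<k. T (f i) \<bullet> f i) \<le> C"
    using nuclear_trace_bounded[OF T] by blast
  have bound: "k \<le> nat \<lceil>C / lam\<rceil>"
    if f: "form_orthonormal (\<lambda>x. x) k f" "\<And>i. i < k \<Longrightarrow> f i \<in> E" for k f
  proof -
    have "real k * lam = (\<Sum>i<k. T (f i) \<bullet> f i)"
      using f by (simp add: eigen form_orthonormal_def)
    also have "\<dots> \<le> C" by (rule C[OF f(1)])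
    finally have "real k \<le> C / lam" using lam by (simp add: field_simps)
    then show ?thesis by linarith
  qed
  obtain k f where f: "form_orthonormal (\<lambda>x. x) k f" "\<And>i. i < k \<Longrightarrow> f i \<in> E"
    and null: "\<And>w. w \<in> E \<Longrightarrow> w - (\<Sum>i<k. (f i \<bullet> w) *\<^sub>R f i) = 0"
    using form_orthonormal_maximal[of "\<lambda>x. x" E "nat \<lceil>C / lam\<rceil>"] E bound
    by (auto simp: linear_ident self_adjoint_def nonneg_operator_def)
  have expand: "w = (\<Sum>i<k. (f i \<bullet> w) *\<^sub>R f i)" if "w \<in> E" for w
    using null[OF that] by simp
  have ind: "inj_on f {..<k}" "independent (f ` {..<k})"
    using biorthogonal_independent[of k f f] f(1) by (auto simp: form_orthonormal_def)
  have "w \<in> span (f ` {..<k})" if "w \<in> E" for w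
  proof -
    have "(\<Sum>i<k. (f i \<bullet> w) *\<^sub>R f i) \<in> span (f ` {..<k})"
      by (intro span_sum span_scale span_base) auto
    then show ?thesis using expand[OF that] by simp
  qed
  then have "dim E = card (f ` {..<k})"
    using f(2) ind(2) by (intro dim_unique) auto
  then have "dim E = k" by (simp add: card_image[OF ind(1)])
  with f expand show ?thesis using that by blast
qed

section \<open>Normal laws and their characteristic functions\<close>

lemma sets_normal_law [simp, measurable_cong]: "sets (normal_law a v) = sets borel"
  by (simp add: normal_law_def)

lemma normal_law_1: "normal_law 0 1 = std_normal_distribution"
  by (simp add: normal_law_def)

lemma real_distribution_std: "real_distribution (normal_law 0 1)"
  unfolding normal_law_1 by (rule real_dist_normal_dist)

lemma normal_law_eq_distr:
  assumes "0 \<le> v"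
  shows "normal_law 0 v = distr (normal_law 0 1) borel (\<lambda>x. sqrt v * x)"
proof (cases "v = 0")
  case True
  interpret real_distribution "normal_law 0 1" by (rule real_distribution_std)
  have "distr (normal_law 0 1) borel (\<lambda>x. 0) = return borel 0" by (rule distr_const) auto
  then show ?thesis by (simp add: True) (simp add: normal_law_def)
next
  case False
  interpret real_distribution "std_normal_distribution" by (rule real_dist_normal_dist)
  have "distributed std_normal_distribution lborel (\<lambda>x. x) std_normal_density"
    by (simp add: distributed_def distr_id2)
  from normal_density_affine[OF this, of "sqrt v" 0] False assms
  have "distributed std_normal_distribution lborel (\<lambda>x. sqrt v * x) (normal_density 0 (sqrt v))" by simp
  then have "distr std_normal_distribution lborel (\<lambda>x. sqrt v * x) = density lborel (normal_density 0 (sqrt v))"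
    by (simp add: distributed_def)
  moreover have "distr std_normal_distribution lborel (\<lambda>x. sqrt v * x) = distr std_normal_distribution borel (\<lambda>x. sqrt v * x)"
    by (rule distr_cong) auto
  ultimately show ?thesis using False by (simp add: normal_law_1) (simp add: normal_law_def)
qed

lemma char_distr:
  assumes [measurable]: "X \<in> borel_measurable M"
  shows "char (distr M borel X) t = (CLINT x|M. iexp (t * X x))"
  by (simp add: char_def integral_distr)

lemma char_normal_law:
  assumes "0 \<le> v"
  shows "char (normal_law 0 v) t = complex_of_real (exp (- (v * t\<^sup>2) / 2))"
proof -
  have "char (normal_law 0 v) t = (CLINT x|normal_law 0 1. iexp (t * (sqrt v * x)))"
    by (subst normal_law_eq_distr[OF assms], subst char_distr) auto
  also have "\<dots> = char (normal_law 0 1) (t * sqrt v)" by (simp add: char_def mult_ac)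
  also have "\<dots> = complex_of_real (exp (- ((t * sqrt v)\<^sup>2) / 2))"
    by (simp add: normal_law_1 char_std_normal_distribution)
  finally show ?thesis using assms by (simp add: power_mult_distrib mult_ac)
qed

section \<open>Independence from joint characteristic functions\<close>

context prob_space
begin

text \<open>
  If the weight \<open>g\<close> is uncorrelated with every \<open>exp (i b X)\<close>, then \<open>X\<close> has the same characteristic
  function under the probability measure with density \<open>g / E g\<close> as under \<open>M\<close>, hence the same law by
  uniqueness of characteristic functions in one dimension.
\<close>
lemma uncorrelated_weight_independent:
  fixes X g :: "'a \<Rightarrow> real"
  assumes [measurable]: "X \<in> borel_measurable M" "g \<in> borel_measurable M" "A \<in> sets borel"
    and g: "\<And>x. 0 \<le> g x" "\<And>x. g x \<le> K"
    and fac: "\<And>b. (CLINT x|M. g x *\<^sub>R iexp (b * X x)) = (\<integral>x. g x \<partial>M) *\<^sub>R (CLINT x|M. iexp (b * X x))"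
  shows "(\<integral>x. g x * indicator A (X x) \<partial>M) = (\<integral>x. g x \<partial>M) * prob (X -` A \<inter> space M)"
proof -
  have int: "integrable M g"
    using g by (intro integrable_const_bound[of _ K]) auto
  define c where "c = (\<integral>x. g x \<partial>M)"
  have c0: "0 \<le> c" using g by (simp add: c_def)
  show ?thesis
  proof (cases "c = 0")
    case True
    then have "AE x in M. g x = 0"
      using int g by (simp add: c_def integral_nonneg_eq_0_iff_AE)
    then have "AE x in M. g x * indicator A (X x) = 0" by auto
    then have "(\<integral>x. g x * indicator A (X x) \<partial>M) = 0" by (simp add: integral_eq_zero_AE)
    with True show ?thesis by (simp add: c_def)
  next
    case False
    then have c: "0 < c" using c0 by simp
    define M' where "M' = density M (\<lambda>x. ennreal (g x / c))"
    have "emeasure M' (space M') = 1"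
    proof -
      have "emeasure M' (space M') = (\<integral>\<^sup>+x. ennreal (g x / c) \<partial>M)"
        by (simp add: M'_def emeasure_density cong: nn_integral_cong)
      also have "\<dots> = ennreal (\<integral>x. g x / c \<partial>M)"
        using int g c by (intro nn_integral_eq_integral) auto
      also have "\<dots> = 1" using c by (simp add: c_def)
      finally show ?thesis .
    qed
    then interpret M': prob_space M' by (rule prob_spaceI)
    have [measurable_cong]: "sets M' = sets M" by (simp add: M'_def)
    have sp: "space M' = space M" by (simp add: M'_def)
    have "distr M' borel X = distr M borel X"
    proof (rule Levy_uniqueness)
      show "real_distribution (distr M' borel X)" "real_distribution (distr M borel X)"
        by (auto intro: M'.real_distribution_distr real_distribution_distr)
      show "char (distr M' borel X) = char (distr M borel X)"
      proof
        fix b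
        have "char (distr M' borel X) b = (CLINT x|M'. iexp (b * X x))" by (rule char_distr) measurable
        also have "\<dots> = (CLINT x|M. (g x / c) *\<^sub>R iexp (b * X x))"
          unfolding M'_def using g c by (subst integral_density) auto
        also have "\<dots> = (CLINT x|M. (1 / c) *\<^sub>R (g x *\<^sub>R iexp (b * X x)))" by simp
        also have "\<dots> = (1 / c) *\<^sub>R (CLINT x|M. g x *\<^sub>R iexp (b * X x))" by (rule integral_scaleR_right)
        also have "\<dots> = (CLINT x|M. iexp (b * X x))" unfolding fac using c by (simp add: c_def)
        finally show "char (distr M' borel X) b = char (distr M borel X) b" by (simp add: char_distr)
      qed
    qed
    then have "measure (distr M' borel X) A = measure (distr M borel X) A" by simp
    then have "M'.prob (X -` A \<inter> space M) = prob (X -` A \<inter> space M)"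
      by (simp add: measure_distr sp)
    moreover have "M'.prob (X -` A \<inter> space M) = (\<integral>x. g x * indicator A (X x) \<partial>M) / c"
    proof -
      have "M'.prob (X -` A \<inter> space M) = (\<integral>x. indicator (X -` A \<inter> space M) x \<partial>M')"
        using sp by (subst Bochner_Integration.integral_indicator) auto
      also have "\<dots> = (\<integral>x. (g x / c) *\<^sub>R indicator (X -` A \<inter> space M) x \<partial>M)"
        unfolding M'_def using g c by (subst integral_density) auto
      also have "\<dots> = (\<integral>x. (g x * indicator A (X x)) / c \<partial>M)"
        by (intro Bochner_Integration.integral_cong) (auto simp: indicator_def)
      finally show ?thesis by simp
    qed
    ultimately show ?thesis using c by (simp add: c_def field_simps)
  qed
qed

text \<open>
  Two applications of the weighting lemma. The weights \<open>1 + cos (a S + t)\<close> are uncorrelated with every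
  \<open>exp (i b X)\<close>, so the event \<open>X \<in> A\<close> is uncorrelated with every \<open>exp (i a S)\<close>; the indicator of this
  event is then itself an admissible weight for \<open>S\<close>. The weights are uncorrelated because their cosine is
  a combination of \<open>exp (i a S)\<close> and \<open>exp (- i a S)\<close>, for which this is the factorisation hypothesis.
\<close>
lemma indep_of_char_factorizes:
  fixes X S :: "'a \<Rightarrow> real"
  assumes [measurable]: "X \<in> borel_measurable M" "S \<in> borel_measurable M"
      "A \<in> sets borel" "B \<in> sets borel"
    and fac: "\<And>a b. (CLINT x|M. iexp (a * S x + b * X x))
      = (CLINT x|M. iexp (a * S x)) * (CLINT x|M. iexp (b * X x))"
  shows "prob {x \<in> space M. X x \<in> A \<and> S x \<in> B}
    = prob (X -` A \<inter> space M) * prob (S -` B \<inter> space M)"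
proof -
  define E F where "E a x = iexp (a * S x)" and "F b x = iexp (b * X x)" for a b x
  define \<phi> \<psi> where "\<phi> a = (CLINT x|M. E a x)" and "\<psi> b = (CLINT x|M. F b x)" for a b
  define p where "p = prob (X -` A \<inter> space M)"
  have intE [simp]: "integrable M (E a)" and intF [simp]: "integrable M (F b)" for a b
    unfolding E_def F_def by (auto intro!: integrable_iexp)
  have EF: "E a x * F b x = iexp (a * S x + b * X x)" for a b x
    by (simp add: E_def F_def distrib_left exp_add)
  have intEF [simp]: "integrable M (\<lambda>x. E a x * F b x)" for a b
    unfolding EF by (auto intro!: integrable_iexp)
  have prod: "(CLINT x|M. E a x * F b x) = \<phi> a * \<psi> b" for a b
    unfolding EF unfolding \<phi>_def \<psi>_def E_def F_def by (rule fac)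
  have cosE: "complex_of_real (cos (a * S x + t)) = (iexp t * E a x + iexp (- t) * E (- a) x) / 2"
    for a t x
  proof -
    have "complex_of_real (cos (a * S x + t)) = (iexp (a * S x + t) + iexp (- (a * S x + t))) / 2"
      by (simp only: cos_of_real[symmetric] cos_exp_eq) (simp add: algebra_simps)
    also have "iexp (a * S x + t) = iexp t * E a x"
      by (simp add: E_def mult_exp_exp algebra_simps)
    also have "iexp (- (a * S x + t)) = iexp (- t) * E (- a) x"
      by (simp add: E_def mult_exp_exp algebra_simps)
    finally show ?thesis .
  qed
  have [simp]: "integrable M (\<lambda>x. cos (f x))"
    if "f \<in> borel_measurable M" for f :: "'a \<Rightarrow> real"
    using that by (auto intro!: integrable_const_bound[of _ 1])
  have cosI: "complex_of_real (\<integral>x. cos (a * S x + t) \<partial>M)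
      = (iexp t * \<phi> a + iexp (- t) * \<phi> (- a)) / 2" for a t
    by (simp only: integral_complex_of_real[symmetric] cosE) (simp add: \<phi>_def)
  have mean: "complex_of_real (\<integral>x. 1 + cos (a * S x + t) \<partial>M)
      = 1 + (iexp t * \<phi> a + iexp (- t) * \<phi> (- a)) / 2" for a t
    by (simp add: prob_space cosI)
  \<comment> \<open>adding 1 makes the weight nonnegative\<close>
  have weight: "(\<integral>x. (1 + cos (a * S x + t)) * indicator A (X x) \<partial>M)
      = (\<integral>x. 1 + cos (a * S x + t) \<partial>M) * p" for a t
    unfolding p_def
  proof (rule uncorrelated_weight_independent[where K=2])
    fix b
    have "(CLINT x|M. (1 + cos (a * S x + t)) *\<^sub>R F b x) =
      (CLINT x|M. F b x + (iexp t * (E a x * F b x) + iexp (- t) * (E (- a) x * F b x)) / 2)"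
      by (rule Bochner_Integration.integral_cong[OF refl])
         (simp only: scaleR_conv_of_real of_real_add of_real_1 cosE,
          simp add: algebra_simps add_divide_distrib)
    also have "\<dots> = \<psi> b + (iexp t * (\<phi> a * \<psi> b) + iexp (- t) * (\<phi> (- a) * \<psi> b)) / 2"
      by (simp add: prod) (simp add: \<psi>_def)
    also have "\<dots> = complex_of_real (\<integral>x. 1 + cos (a * S x + t) \<partial>M) * \<psi> b"
      by (simp only: mean) (simp add: algebra_simps add_divide_distrib)
    finally show "(CLINT x|M. (1 + cos (a * S x + t)) *\<^sub>R iexp (b * X x)) =
      (\<integral>x. 1 + cos (a * S x + t) \<partial>M) *\<^sub>R (CLINT x|M. iexp (b * X x))"
      by (simp only: \<psi>_def F_def scaleR_conv_of_real)
  next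
    fix x show "0 \<le> 1 + cos (a * S x + t)" using cos_ge_minus_one[of "a * S x + t"] by linarith
    show "1 + cos (a * S x + t) \<le> 2" using cos_le_one[of "a * S x + t"] by linarith
  qed auto
  have ind_eq: "indicator A (X x) = (indicator (X -` A \<inter> space M) x :: real)" if "x \<in> space M" for x
    using that by (simp add: indicator_def)
  have intA: "(\<integral>x. indicator A (X x) \<partial>M) = p"
    unfolding p_def by (subst Bochner_Integration.integral_cong[OF refl ind_eq]) auto
  have [simp]: "integrable M (\<lambda>x. indicator A (X x) * cos (f x) :: real)"
    if "f \<in> borel_measurable M" for f :: "'a \<Rightarrow> real"
    using that by (auto intro!: integrable_const_bound[of _ 1] simp: abs_mult indicator_def)
  have [simp]: "integrable M (\<lambda>x. indicator A (X x) :: real)"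
    by (intro integrable_const_bound[of _ 1]) (auto simp: indicator_def)
  have cosA: "(\<integral>x. indicator A (X x) * cos (a * S x + t) \<partial>M) = p * (\<integral>x. cos (a * S x + t) \<partial>M)" for a t
    using weight[of a t] by (simp add: distrib_right distrib_left intA prob_space mult.commute)
  \<comment> \<open>the phase \<open>- pi / 2\<close> turns the cosine into the sine\<close>
  define s where "s = - (pi / 2)"
  have E_cos: "E a x = complex_of_real (cos (a * S x + 0)) + \<i> * complex_of_real (cos (a * S x + s))" for a x
  proof -
    have "cos (a * S x + s) = sin (a * S x)" unfolding s_def by (simp add: cos_diff)
    moreover have "E a x = complex_of_real (cos (a * S x)) + \<i> * complex_of_real (sin (a * S x))"
      unfolding E_def by (simp only: exp_Euler cos_of_real sin_of_real)
    ultimately show ?thesis by simp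
  qed
  have \<phi>_cos: "\<phi> a = complex_of_real (\<integral>x. cos (a * S x + 0) \<partial>M) + \<i> * complex_of_real (\<integral>x. cos (a * S x + s) \<partial>M)" for a
    unfolding \<phi>_def E_cos by simp
  have "(\<integral>x. indicator A (X x) * indicator B (S x) \<partial>M)
    = (\<integral>x. indicator A (X x) \<partial>M) * prob (S -` B \<inter> space M)"
  proof (rule uncorrelated_weight_independent[where K=1])
    fix a
    have "(CLINT x|M. indicator A (X x) *\<^sub>R E a x) =
        (CLINT x|M. complex_of_real (indicator A (X x) * cos (a * S x + 0))
                  + \<i> * complex_of_real (indicator A (X x) * cos (a * S x + s)))"
      by (rule Bochner_Integration.integral_cong[OF refl])
        (simp only: E_cos, simp add: scaleR_conv_of_real algebra_simps)
    also have "\<dots> = complex_of_real (\<integral>x. indicator A (X x) * cos (a * S x + 0) \<partial>M)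
                  + \<i> * complex_of_real (\<integral>x. indicator A (X x) * cos (a * S x + s) \<partial>M)"
      by (simp del: of_real_mult)
    also have "\<dots> = p * \<phi> a"
      by (simp only: cosA \<phi>_cos) (simp add: algebra_simps)
    finally show "(CLINT x|M. indicator A (X x) *\<^sub>R iexp (a * S x)) =
        (\<integral>x. indicator A (X x) \<partial>M) *\<^sub>R (CLINT x|M. iexp (a * S x))"
      by (simp add: intA scaleR_conv_of_real \<phi>_def E_def)
  qed (auto simp: indicator_def)
  moreover have "(\<integral>x. indicator A (X x) * indicator B (S x) \<partial>M)
      = (\<integral>x. indicator {x \<in> space M. X x \<in> A \<and> S x \<in> B} x \<partial>M :: real)"
    by (rule Bochner_Integration.integral_cong) (auto simp: indicator_def)
  ultimately show ?thesis by (simp add: intA p_def)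
qed

end

section \<open>Standard Gaussian families\<close>

interpretation std: real_distribution "normal_law 0 1" by (rule real_distribution_std)

interpretation std_prod: product_sigma_finite "\<lambda>_::nat. normal_law 0 1"
  by unfold_locales

text \<open>
  A family of coordinates of a standard Gaussian vector, characterised by the laws of its linear
  combinations, which is the form in which Gaussian measures are given. Independence is a consequence.
\<close>
definition standard_gaussian_family :: "'b measure \<Rightarrow> nat \<Rightarrow> (nat \<Rightarrow> 'b \<Rightarrow> real) \<Rightarrow> bool"
  where "standard_gaussian_family M k Z \<longleftrightarrow> prob_space M \<and> (\<forall>i<k. Z i \<in> borel_measurable M) \<and>
    (\<forall>t. distr M borel (\<lambda>x. \<Sum>i<k. t i * Z i x) = normal_law 0 (\<Sum>i<k. (t i)\<^sup>2))"

lemma standard_gaussian_familyD: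
  assumes "standard_gaussian_family M k Z"
  shows "prob_space M" "i < k \<Longrightarrow> Z i \<in> borel_measurable M"
    "distr M borel (\<lambda>x. \<Sum>i<k. t i * Z i x) = normal_law 0 (\<Sum>i<k. (t i)\<^sup>2)"
  using assms by (auto simp: standard_gaussian_family_def)

lemma standard_gaussian_family_distr1:
  assumes Z: "standard_gaussian_family M k Z" and i: "i < k"
  shows "distr M borel (Z i) = normal_law 0 1"
proof -
  have "(\<Sum>j<k. (if j = i then 1 else 0) * Z j x) = Z i x" for x
    using i by (simp add: if_distrib[of "\<lambda>c. c * _"] cong: if_cong)
  moreover have "(\<Sum>j<k. ((if j = i then 1 else 0)::real)\<^sup>2) = 1"
    using i by (simp add: if_distrib[of "\<lambda>c. c\<^sup>2"] cong: if_cong)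
  ultimately show ?thesis
    using standard_gaussian_familyD(3)[OF Z, of "\<lambda>j. if j = i then 1 else 0"] by simp
qed

text \<open>
  The joint characteristic function of the last member and a combination \<open>S\<close> of the others is read
  off from the law of \<open>a S + b Z k\<close>: variances add, so it factorises.
\<close>
lemma standard_gaussian_family_indep_last:
  fixes Z :: "nat \<Rightarrow> 'b \<Rightarrow> real"
  assumes Z: "standard_gaussian_family M (Suc k) Z" and [measurable]: "A \<in> sets borel" "B \<in> sets borel"
  shows "measure M {x \<in> space M. Z k x \<in> A \<and> (\<Sum>i<k. t i * Z i x) \<in> B}
    = measure M (Z k -` A \<inter> space M) * measure M ((\<lambda>x. \<Sum>i<k. t i * Z i x) -` B \<inter> space M)"
proof -
  interpret prob_space M using Z by (rule standard_gaussian_familyD)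
  have [measurable]: "Z i \<in> borel_measurable M" if "i \<le> k" for i
    using standard_gaussian_familyD(2)[OF Z, of i] that by simp
  define S where "S x = (\<Sum>i<k. t i * Z i x)" for x
  define s where "s = (\<Sum>i<k. (t i)\<^sup>2)"
  have s0: "0 \<le> s" by (simp add: s_def sum_nonneg)
  have [measurable]: "S \<in> borel_measurable M"
    unfolding S_def by (intro borel_measurable_sum borel_measurable_times) auto
  have law: "distr M borel (\<lambda>x. a * S x + b * Z k x) = normal_law 0 (a\<^sup>2 * s + b\<^sup>2)" for a b
  proof -
    let ?u = "\<lambda>i. if i = k then b else a * t i"
    have "a * S x + b * Z k x = (\<Sum>i<Suc k. ?u i * Z i x)" for x
      by (simp add: S_def sum_distrib_left mult.assoc)
    moreover have "a\<^sup>2 * s + b\<^sup>2 = (\<Sum>i<Suc k. (?u i)\<^sup>2)"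
      by (simp add: s_def sum_distrib_left power_mult_distrib)
    ultimately show ?thesis using standard_gaussian_familyD(3)[OF Z, of ?u] by presburger
  qed
  have chf: "(CLINT x|M. iexp (a * S x + b * Z k x)) = complex_of_real (exp (- (a\<^sup>2 * s + b\<^sup>2) / 2))" for a b
    using char_distr[of "\<lambda>x. a * S x + b * Z k x" M 1] char_normal_law[of "a\<^sup>2 * s + b\<^sup>2" 1] s0
    by (simp add: law)
  have "prob {x \<in> space M. Z k x \<in> A \<and> S x \<in> B} = prob (Z k -` A \<inter> space M) * prob (S -` B \<inter> space M)"
  proof (rule indep_of_char_factorizes)
    fix a b
    show "(CLINT x|M. iexp (a * S x + b * Z k x)) = (CLINT x|M. iexp (a * S x)) * (CLINT x|M. iexp (b * Z k x))"
    proof -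
      have "(CLINT x|M. iexp (a * S x)) = complex_of_real (exp (- (a\<^sup>2 * s) / 2))"
        "(CLINT x|M. iexp (b * Z k x)) = complex_of_real (exp (- (b\<^sup>2) / 2))"
        using chf[of a 0] chf[of 0 b] by simp_all
      moreover have "exp (- (a\<^sup>2 * s + b\<^sup>2) / 2) = exp (- (a\<^sup>2 * s) / 2) * exp (- (b\<^sup>2) / 2)"
        by (simp add: mult_exp_exp field_simps)
      ultimately show ?thesis by (simp only: chf of_real_mult)
    qed
  qed auto
  then show ?thesis by (simp add: S_def[abs_def])
qed

text \<open>
  Induction on the size of the family, over all probability measures: conditioning on \<open>Z k \<in> A k\<close>
  leaves the law of every combination of the other members unchanged, so they form a standard Gaussian
  family under the conditional measure as well.
\<close>
lemma standard_gaussian_family_measure: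
  assumes "standard_gaussian_family M k Z" "\<And>i. i < k \<Longrightarrow> A i \<in> sets borel"
  shows "measure M {x \<in> space M. \<forall>i<k. Z i x \<in> A i} = (\<Prod>i<k. measure (normal_law 0 1) (A i))"
  using assms
proof (induction k arbitrary: M)
  case 0
  interpret prob_space M using 0 by (simp add: standard_gaussian_family_def)
  show ?case by (simp add: prob_space)
next
  case (Suc k)
  note Z = Suc.prems(1)
  interpret prob_space M using Z by (rule standard_gaussian_familyD)
  have Zm: "Z i \<in> borel_measurable M" if "i \<le> k" for i
    using standard_gaussian_familyD(2)[OF Z, of i] that by simp
  have [measurable]: "Z k \<in> borel_measurable M" "A k \<in> sets borel"
    using Zm Suc.prems(2) by auto
  have Am: "A i \<in> sets borel" if "i \<le> k" for i using Suc.prems(2) that by simp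
  define E where "E = Z k -` A k \<inter> space M"
  have [measurable]: "E \<in> sets M" unfolding E_def by measurable
  define p where "p = prob E"
  have pN: "p = measure (normal_law 0 1) (A k)"
    unfolding p_def E_def standard_gaussian_family_distr1[OF Z, of k, simplified, symmetric]
    by (simp add: measure_distr)
  define R where "R = {x \<in> space M. \<forall>i<k. Z i x \<in> A i}"
  have [measurable]: "R \<in> sets M"
  proof -
    have "R = (\<Inter>i\<in>{..<k}. Z i -` A i \<inter> space M) \<inter> space M" by (auto simp: R_def)
    also have "\<dots> \<in> sets M"
    proof (cases "k = 0")
      case False
      then show ?thesis
        by (intro sets.Int[OF sets.finite_INT sets.top] measurable_sets[OF Zm Am]) auto
    qed simp
    finally show ?thesis .
  qed
  have split: "{x \<in> space M. \<forall>i<Suc k. Z i x \<in> A i} = E \<inter> R"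
    by (auto simp: E_def R_def less_Suc_eq)
  show ?case
  proof (cases "p = 0")
    case True
    have "prob (E \<inter> R) \<le> p" unfolding p_def by (intro finite_measure_mono) auto
    then have "prob (E \<inter> R) = 0" using True measure_nonneg[of M "E \<inter> R"] by linarith
    then show ?thesis using True pN by (simp add: split)
  next
    case False
    then have p: "0 < p" using measure_nonneg[of M E] unfolding p_def by linarith
    define M' where "M' = uniform_measure M E"
    have E0: "emeasure M E \<noteq> 0" "emeasure M E \<noteq> \<infinity>"
      using p by (auto simp: emeasure_eq_measure p_def)
    interpret M': prob_space M' unfolding M'_def by (rule prob_space_uniform_measure[OF E0])
    have [measurable_cong]: "sets M' = sets M" and sp: "space M' = space M" by (simp_all add: M'_def)
    have cond: "M'.prob B = prob (E \<inter> B) / p" if "B \<in> sets M" for B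
      unfolding M'_def p_def using E0 that by (intro measure_uniform_measure)
    have "standard_gaussian_family M' k Z"
      unfolding standard_gaussian_family_def
    proof (intro conjI allI impI)
      show "prob_space M'" by (rule M'.prob_space_axioms)
      fix i assume "i < k" then show "Z i \<in> borel_measurable M'"
        using Zm[of i] unfolding M'_def by (simp add: measurable_cong_sets[OF sets_uniform_measure refl])
    next
      fix t
      define S where "S x = (\<Sum>i<k. t i * Z i x)" for x
      have [measurable]: "S \<in> borel_measurable M"
        unfolding S_def using Zm by (intro borel_measurable_sum borel_measurable_times) auto
      have "distr M' borel S = distr M borel S"
      proof (rule measure_eqI)
        fix B assume "B \<in> sets (distr M' borel S)"
        then have [measurable]: "B \<in> sets borel" by simp
        have "M'.prob (S -` B \<inter> space M) = prob (S -` B \<inter> space M)"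
        proof -
          have "E \<inter> (S -` B \<inter> space M) = {x \<in> space M. Z k x \<in> A k \<and> S x \<in> B}"
            by (auto simp: E_def)
          then have "prob (E \<inter> (S -` B \<inter> space M)) = p * prob (S -` B \<inter> space M)"
            using standard_gaussian_family_indep_last[OF Z, of "A k" B t] by (simp add: S_def[abs_def] p_def E_def)
          then show ?thesis using p by (simp add: cond)
        qed
        then show "emeasure (distr M' borel S) B = emeasure (distr M borel S) B"
          by (simp add: emeasure_distr sp M'.emeasure_eq_measure emeasure_eq_measure)
      qed simp
      also have "\<dots> = normal_law 0 (\<Sum>i<k. (t i)\<^sup>2)"
        using standard_gaussian_familyD(3)[OF Z, of "t(k := 0)"]
        by (simp add: S_def[abs_def])
      finally show "distr M' borel (\<lambda>x. \<Sum>i<k. t i * Z i x) = normal_law 0 (\<Sum>i<k. (t i)\<^sup>2)"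
        by (simp add: S_def[abs_def])
    qed
    from Suc.IH[OF this] Am have "M'.prob R = (\<Prod>i<k. measure (normal_law 0 1) (A i))"
      by (simp add: R_def sp)
    with cond[of R] p have "prob (E \<inter> R) = (\<Prod>i<k. measure (normal_law 0 1) (A i)) * p"
      by (simp add: field_simps)
    then show ?thesis by (simp add: split pN)
  qed
qed

lemma standard_gaussian_family_distr:
  assumes Z: "standard_gaussian_family M k Z"
  shows "distr M (\<Pi>\<^sub>M i\<in>{..<k}. borel) (\<lambda>x. \<lambda>i\<in>{..<k}. Z i x) = (\<Pi>\<^sub>M i\<in>{..<k}. normal_law 0 1)"
proof (rule std_prod.PiM_eqI)
  interpret prob_space M using Z by (rule standard_gaussian_familyD)
  have m: "(\<lambda>x. \<lambda>i\<in>{..<k}. Z i x) \<in> measurable M (\<Pi>\<^sub>M i\<in>{..<k}. borel)"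
    using standard_gaussian_familyD(2)[OF Z] by (intro measurable_restrict) auto
  show "sets (distr M (\<Pi>\<^sub>M i\<in>{..<k}. borel) (\<lambda>x. \<lambda>i\<in>{..<k}. Z i x)) = sets (\<Pi>\<^sub>M i\<in>{..<k}. normal_law 0 1)"
    by (simp cong: sets_PiM_cong)
  fix A assume A: "\<And>i. i \<in> {..<k} \<Longrightarrow> A i \<in> sets (normal_law 0 1)"
  then have "Pi\<^sub>E {..<k} A \<in> sets (\<Pi>\<^sub>M i\<in>{..<k}. borel)"
    by (intro sets_PiM_I_finite) simp_all
  then have "emeasure (distr M (\<Pi>\<^sub>M i\<in>{..<k}. borel) (\<lambda>x. \<lambda>i\<in>{..<k}. Z i x)) (Pi\<^sub>E {..<k} A)
      = emeasure M ((\<lambda>x. \<lambda>i\<in>{..<k}. Z i x) -` Pi\<^sub>E {..<k} A \<inter> space M)"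
    by (rule emeasure_distr[OF m])
  also have "(\<lambda>x. \<lambda>i\<in>{..<k}. Z i x) -` Pi\<^sub>E {..<k} A \<inter> space M = {x \<in> space M. \<forall>i<k. Z i x \<in> A i}"
    by (auto simp: PiE_def Pi_def)
  also have "emeasure M \<dots> = ennreal (\<Prod>i<k. measure (normal_law 0 1) (A i))"
    using standard_gaussian_family_measure[OF Z, of A] A by (simp add: emeasure_eq_measure)
  also have "\<dots> = (\<Prod>i<k. emeasure (normal_law 0 1) (A i))"
    by (simp add: std.emeasure_eq_measure prod_ennreal)
  finally show "emeasure (distr M (\<Pi>\<^sub>M i\<in>{..<k}. borel) (\<lambda>x. \<lambda>i\<in>{..<k}. Z i x)) (Pi\<^sub>E {..<k} A)
      = (\<Prod>i<k. emeasure (normal_law 0 1) (A i))" .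
qed simp

section \<open>Chi-squared and Fisher laws\<close>

lemma standard_gaussian_family_chi_squared:
  assumes Z: "standard_gaussian_family M k Z"
  shows "distr M borel (\<lambda>x. \<Sum>i<k. (Z i x)\<^sup>2) = chi_squared k"
proof -
  have m: "(\<lambda>x. \<lambda>i\<in>{..<k}. Z i x) \<in> measurable M (\<Pi>\<^sub>M i\<in>{..<k}. borel)"
    using standard_gaussian_familyD(2)[OF Z] by (intro measurable_restrict) auto
  have q: "(\<lambda>x. \<Sum>i<k. (x i)\<^sup>2) \<in> borel_measurable (\<Pi>\<^sub>M i\<in>{..<k}. (borel :: real measure))"
    by measurable
  show ?thesis
    unfolding chi_squared_def standard_gaussian_family_distr[OF Z, symmetric]
    by (subst distr_distr[OF q m]) (simp add: o_def)
qed

text \<open>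
  The first \<open>m\<close> and the last \<open>n\<close> members are two independent standard Gaussian families, since setting
  the coefficients of the others to 0 leaves the defining property.
\<close>
lemma standard_gaussian_family_fisher:
  assumes Z: "standard_gaussian_family M (m + n) Z" and mn: "0 < m" "0 < n"
  shows "distr M borel (\<lambda>x. ((\<Sum>i<m. (Z i x)\<^sup>2) / real m) / ((\<Sum>j<n. (Z (m + j) x)\<^sup>2) / real n)) = fisher m n"
proof -
  interpret prob_space M using Z by (rule standard_gaussian_familyD)
  have Zm: "Z i \<in> borel_measurable M" if "i < m + n" for i
    using standard_gaussian_familyD(2)[OF Z] that by simp
  have sum_split: "(\<Sum>i<m + n. f i) = (\<Sum>i<m. f i) + (\<Sum>j<n. f (m + j))" for f :: "nat \<Rightarrow> real"
    by (induction n) auto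
  have sum_shift: "(\<Sum>i\<in>{m..<m + n}. f i) = (\<Sum>j<n. f (m + j))" for f :: "nat \<Rightarrow> real"
    by (induction n) auto
  have Z1: "standard_gaussian_family M m Z"
    unfolding standard_gaussian_family_def
  proof (intro conjI allI impI)
    fix t
    show "distr M borel (\<lambda>x. \<Sum>i<m. t i * Z i x) = normal_law 0 (\<Sum>i<m. (t i)\<^sup>2)"
      using standard_gaussian_familyD(3)[OF Z, of "\<lambda>i. if i < m then t i else 0"] by (simp add: sum_split)
  qed (use Zm prob_space_axioms in auto)
  have Z2: "standard_gaussian_family M n (\<lambda>j. Z (m + j))"
    unfolding standard_gaussian_family_def
  proof (intro conjI allI impI)
    fix t
    show "distr M borel (\<lambda>x. \<Sum>i<n. t i * Z (m + i) x) = normal_law 0 (\<Sum>i<n. (t i)\<^sup>2)"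
      using standard_gaussian_familyD(3)[OF Z, of "\<lambda>i. if i < m then 0 else t (i - m)"] by (simp add: sum_split)
  qed (use Zm prob_space_axioms in auto)
  let ?X = "\<lambda>x. \<Sum>i<m. (Z i x)\<^sup>2" and ?Y = "\<lambda>x. \<Sum>j<n. (Z (m + j) x)\<^sup>2"
  have ind: "indep_vars (\<lambda>_. borel) Z {..<m + n}"
  proof (subst indep_vars_iff_distr_eq_PiM')
    show "distr M (\<Pi>\<^sub>M i\<in>{..<m + n}. borel) (\<lambda>x. \<lambda>i\<in>{..<m + n}. Z i x)
      = (\<Pi>\<^sub>M i\<in>{..<m + n}. distr M borel (Z i))"
      unfolding standard_gaussian_family_distr[OF Z]
      by (intro PiM_cong) (simp_all add: standard_gaussian_family_distr1[OF Z])
  qed (use Zm mn in auto)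
  have "indep_var (\<Pi>\<^sub>M i\<in>{..<m}. borel) (\<lambda>x. \<lambda>i\<in>{..<m}. Z i x)
      (\<Pi>\<^sub>M i\<in>{m..<m + n}. borel) (\<lambda>x. \<lambda>i\<in>{m..<m + n}. Z i x)"
    by (rule indep_var_restrict[OF ind]) auto
  from indep_var_compose[OF this, of "\<lambda>z. \<Sum>i\<in>{..<m}. (z i)\<^sup>2" borel "\<lambda>z. \<Sum>i\<in>{m..<m + n}. (z i)\<^sup>2" borel]
  have "indep_var borel (\<lambda>x. \<Sum>i\<in>{..<m}. (Z i x)\<^sup>2) borel (\<lambda>x. \<Sum>i\<in>{m..<m + n}. (Z i x)\<^sup>2)"
    by (simp add: o_def)
  also have "(\<lambda>x. \<Sum>i\<in>{m..<m + n}. (Z i x)\<^sup>2) = ?Y"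
    unfolding sum_shift ..
  finally have iv: "indep_var borel ?X borel ?Y" .
  define X Y where "X = ?X" and "Y = ?Y"
  have iv: "indep_var borel X borel Y" using iv by (simp only: X_def Y_def)
  then have [measurable]: "X \<in> borel_measurable M" "Y \<in> borel_measurable M"
    by (rule indep_var_rv1, rule indep_var_rv2)
  have "fisher m n = distr (distr M borel X \<Otimes>\<^sub>M distr M borel Y) borel (\<lambda>(u, v). (u / real m) / (v / real n))"
    unfolding fisher_def X_def Y_def
      standard_gaussian_family_chi_squared[OF Z1] standard_gaussian_family_chi_squared[OF Z2] ..
  also have "distr M borel X \<Otimes>\<^sub>M distr M borel Y = distr M (borel \<Otimes>\<^sub>M borel) (\<lambda>x. (X x, Y x))"
    using iv by (simp add: indep_var_distribution_eq)
  also have "distr \<dots> borel (\<lambda>(u, v). (u / real m) / (v / real n)) = distr M borel (\<lambda>x. (X x / real m) / (Y x / real n))"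
    by (subst distr_distr) (auto simp: o_def)
  finally show ?thesis by (simp only: X_def Y_def)
qed

lemma AE_normal_law_neq: "AE y in normal_law 0 1. y \<noteq> s"
  unfolding normal_law_1 using AE_lborel_singleton[of s] by (subst AE_density) auto

lemma AE_normal_law_square_neq: "AE y in normal_law 0 1. s + y\<^sup>2 \<noteq> t"
  using AE_normal_law_neq[of "sqrt (t - s)"] AE_normal_law_neq[of "- sqrt (t - s)"]
proof eventually_elim
  case (elim y)
  show ?case
  proof
    assume "s + y\<^sup>2 = t"
    then have "\<bar>y\<bar> = sqrt (t - s)" by (auto simp flip: real_sqrt_abs)
    with elim show False by (auto simp: abs_if split: if_splits)
  qed
qed

lemma measurable_sum_squares [measurable]:
  "(\<lambda>x. \<Sum>i<k. (x i)\<^sup>2) \<in> borel_measurable (\<Pi>\<^sub>M i\<in>{..<k}. normal_law 0 1)"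
  by measurable

lemma prob_space_chi_squared: "prob_space (chi_squared k)"
proof -
  interpret prob_space "\<Pi>\<^sub>M i\<in>{..<k}. normal_law 0 1"
    by (intro prob_space_PiM std.prob_space_axioms)
  show ?thesis unfolding chi_squared_def by (rule prob_space_distr) measurable
qed

lemma sets_chi_squared [simp, measurable_cong]: "sets (chi_squared k) = sets borel"
  by (simp add: chi_squared_def)

text \<open>
  By Fubini: once all coordinates but one are fixed, the sum of squares equals \<open>t\<close> for at most two
  values of the remaining one.
\<close>
lemma AE_chi_squared_neq:
  assumes "0 < k"
  shows "AE u in chi_squared k. u \<noteq> t"
proof -
  obtain j where k: "k = Suc j" using assms by (cases k) auto
  let ?f = "\<lambda>x. indicator {t} (\<Sum>i<Suc j. (x i)\<^sup>2) :: ennreal"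
  have meas: "?f \<in> borel_measurable (Pi\<^sub>M (insert j {..<j}) (\<lambda>_. normal_law 0 1))"
    unfolding lessThan_Suc[symmetric] by measurable
  have "(\<integral>\<^sup>+x. ?f x \<partial>(\<Pi>\<^sub>M i\<in>insert j {..<j}. normal_law 0 1))
      = (\<integral>\<^sup>+x. (\<integral>\<^sup>+y. ?f (x(j := y)) \<partial>normal_law 0 1) \<partial>(\<Pi>\<^sub>M i\<in>{..<j}. normal_law 0 1))"
    by (rule std_prod.product_nn_integral_insert[OF _ _ meas]) auto
  also have "\<dots> = (\<integral>\<^sup>+x. 0 \<partial>(\<Pi>\<^sub>M i\<in>{..<j}. normal_law 0 1))"
  proof (rule nn_integral_cong)
    fix x :: "nat \<Rightarrow> real"
    have "AE y in normal_law 0 1. ?f (x(j := y)) = 0"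
      using AE_normal_law_square_neq[of "\<Sum>i<j. (x i)\<^sup>2" t] by eventually_elim (auto simp: indicator_def)
    then have "(\<integral>\<^sup>+y. ?f (x(j := y)) \<partial>normal_law 0 1) = (\<integral>\<^sup>+y. 0 \<partial>normal_law 0 1)"
      by (rule nn_integral_cong_AE)
    then show "(\<integral>\<^sup>+y. ?f (x(j := y)) \<partial>normal_law 0 1) = 0" by simp
  qed
  finally have "(\<integral>\<^sup>+x. ?f x \<partial>(\<Pi>\<^sub>M i\<in>{..<k}. normal_law 0 1)) = 0"
    by (simp add: k lessThan_Suc)
  moreover have "?f \<in> borel_measurable (\<Pi>\<^sub>M i\<in>{..<k}. normal_law 0 1)"
    using meas by (simp add: k lessThan_Suc)
  ultimately have "AE x in \<Pi>\<^sub>M i\<in>{..<k}. normal_law 0 1. ?f x = 0"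
    by (simp only: nn_integral_0_iff_AE)
  then have "AE x in \<Pi>\<^sub>M i\<in>{..<k}. normal_law 0 1. (\<Sum>i<k. (x i)\<^sup>2) \<noteq> t"
    by eventually_elim (simp add: k indicator_def split: if_splits)
  then show ?thesis unfolding chi_squared_def by (subst AE_distr_iff) auto
qed

lemma fisher_map_measurable [measurable]:
  "(\<lambda>(u, v). (u / real m) / (v / real n)) \<in> borel_measurable (chi_squared m \<Otimes>\<^sub>M chi_squared n)"
  by measurable

lemma real_distribution_fisher: "real_distribution (fisher m n)"
proof -
  interpret m: prob_space "chi_squared m" by (rule prob_space_chi_squared)
  interpret n: prob_space "chi_squared n" by (rule prob_space_chi_squared)
  interpret pair_prob_space "chi_squared m" "chi_squared n" ..
  show ?thesis unfolding fisher_def by (rule real_distribution_distr) measurable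
qed

text \<open>
  For fixed \<open>u \<noteq> 0\<close> the quotient equals \<open>q\<close> for at most one \<open>v \<noteq> 0\<close>. A zero numerator or
  denominator makes the quotient 0, which is excluded separately, as \<open>q\<close> may be 0.
\<close>
lemma AE_fisher_neq:
  assumes mn: "0 < m" "0 < n"
  shows "AE x in fisher m n. x \<noteq> q"
proof -
  interpret m: prob_space "chi_squared m" by (rule prob_space_chi_squared)
  interpret n: prob_space "chi_squared n" by (rule prob_space_chi_squared)
  interpret pair_prob_space "chi_squared m" "chi_squared n" ..
  have "AE u in chi_squared m. AE v in chi_squared n.
      (case (u, v) of (u, v) \<Rightarrow> (u / real m) / (v / real n) \<noteq> q)"
    using AE_chi_squared_neq[OF mn(1), of 0]
  proof eventually_elim
    case (elim u)
    show ?case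
      using AE_chi_squared_neq[OF mn(2), of 0] AE_chi_squared_neq[OF mn(2), of "u * real n / (real m * q)"]
    proof eventually_elim
      case (elim v)
      show ?case
      proof (cases "q = 0")
        case True
        then show ?thesis using elim \<open>u \<noteq> 0\<close> mn by simp
      next
        case False
        with elim mn have "v * (real m * q) \<noteq> u * real n" by (simp add: eq_divide_eq)
        then show ?thesis using elim mn by (auto simp: field_simps)
      qed
    qed
  qed
  then have "AE z in chi_squared m \<Otimes>\<^sub>M chi_squared n. (case z of (u, v) \<Rightarrow> (u / real m) / (v / real n) \<noteq> q)"
    by (intro AE_pair_measure) measurable
  then show ?thesis
    unfolding fisher_def by (subst AE_distr_iff) (auto simp: case_prod_beta)
qed

text \<open>
  Right continuity of the distribution function gives \<open>a \<le> cdf M q\<close> at the quantile \<open>q\<close>, which bounds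
  the probability of \<open>{q<..}\<close>; the point \<open>q\<close> itself has to carry no mass.
\<close>
lemma (in real_distribution) prob_ge_quantile_le:
  assumes a: "0 < a" "a < 1" and atom: "prob {quantile M a} = 0"
  shows "prob {quantile M a..} \<le> 1 - a"
proof -
  define S where "S = {x. a \<le> cdf M x}"
  define q where "q = quantile M a"
  have q: "q = Inf S" by (simp add: q_def quantile_def S_def)
  have "eventually (\<lambda>x. a < cdf M x) at_top" using cdf_lim_at_top_prob a(2) by (rule order_tendstoD)
  then obtain x where "a < cdf M x" by (auto simp: eventually_at_top_linorder)
  then have ne: "S \<noteq> {}" by (auto simp: S_def intro: less_imp_le)
  have "eventually (\<lambda>x. cdf M x < a) at_bot" using cdf_lim_at_bot a(1) by (rule order_tendstoD)
  then obtain l where l: "\<And>x. x \<le> l \<Longrightarrow> cdf M x < a" by (auto simp: eventually_at_bot_linorder)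
  have "a \<le> cdf M q"
  proof (rule tendsto_lowerbound)
    show "(cdf M \<longlongrightarrow> cdf M q) (at_right q)" using cdf_is_right_cont[of q] by (simp add: continuous_within)
    have "a \<le> cdf M x" if "q < x" for x
    proof -
      obtain s where "s \<in> S" "s < x" using cInf_lessD[OF ne, of x] \<open>q < x\<close> q by blast
      then show ?thesis using cdf_nondecreasing[of s x] by (simp add: S_def)
    qed
    then show "eventually (\<lambda>x. a \<le> cdf M x) (at_right q)"
      by (auto simp: eventually_at_right_field intro: exI[of _ "q + 1"])
  qed simp
  moreover have "prob {q..} = prob {q} + prob {q<..}"
    by (subst finite_measure_Union[symmetric]) (auto intro!: arg_cong[where f=prob])
  moreover have "prob {q<..} = 1 - cdf M q"
    unfolding cdf_def using prob_compl[of "{..q}"] by (simp add: Compl_eq_Diff_UNIV[symmetric])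
  ultimately show ?thesis using atom by (simp add: q_def)
qed

lemma fisher_quantile_tail:
  assumes "0 < m" "0 < n" "0 < \<alpha>" "\<alpha> < 1"
  shows "measure (fisher m n) {quantile (fisher m n) (1 - \<alpha>)..} \<le> \<alpha>"
proof -
  interpret real_distribution "fisher m n" by (rule real_distribution_fisher)
  have "prob {q} = 0" for q
    using AE_fisher_neq[OF assms(1,2), of q] by (subst prob_eq_0) auto
  from prob_ge_quantile_le[OF _ _ this, of "1 - \<alpha>"] assms show ?thesis by simp
qed

section \<open>Gaussian measures on the Hilbert space\<close>

text \<open>
  \<open>Q\<close>-orthonormality says that the covariance matrix of the functionals \<open>g i\<close> is \<open>\<sigma>\<^sup>2\<close> times the identity.
\<close>
lemma gaussian_measure_standard_family:
  assumes M: "gaussian_measure M \<zeta> (\<lambda>x. \<sigma>\<^sup>2 *\<^sub>R Q x)" and \<sigma>: "0 < \<sigma>" and Q: "linear Q"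
    and g: "form_orthonormal Q k g" "\<And>i. i < k \<Longrightarrow> g i \<bullet> \<zeta> = 0"
  shows "standard_gaussian_family M k (\<lambda>i y. (g i \<bullet> y) / \<sigma>)"
  unfolding standard_gaussian_family_def
proof (intro conjI allI impI)
  show "prob_space M" using M by (simp add: gaussian_measure_def)
  have sets: "sets M = sets borel" using M by (simp add: gaussian_measure_def)
  fix i
  have "(\<lambda>y. (g i \<bullet> y) / \<sigma>) \<in> borel_measurable borel"
    by (intro borel_measurable_continuous_onI continuous_intros) (use \<sigma> in auto)
  then show "(\<lambda>y. (g i \<bullet> y) / \<sigma>) \<in> borel_measurable M" by (simp add: measurable_cong_sets[OF sets refl])
next
  fix t :: "nat \<Rightarrow> real"
  define b where "b = (\<Sum>i<k. t i *\<^sub>R g i)"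
  have "(\<Sum>i<k. t i * ((g i \<bullet> y) / \<sigma>)) = ((1 / \<sigma>) *\<^sub>R b) \<bullet> y" for y
    by (simp add: b_def inner_sum_left sum_divide_distrib)
  moreover have "distr M borel (\<lambda>y. ((1 / \<sigma>) *\<^sub>R b) \<bullet> y) = normal_law (((1 / \<sigma>) *\<^sub>R b) \<bullet> \<zeta>)
      ((\<sigma>\<^sup>2 *\<^sub>R Q ((1 / \<sigma>) *\<^sub>R b)) \<bullet> ((1 / \<sigma>) *\<^sub>R b))"
    using M unfolding gaussian_measure_def by blast
  moreover have "b \<bullet> \<zeta> = 0" using g(2) by (simp add: b_def inner_sum_left)
  moreover have "(\<sigma>\<^sup>2 *\<^sub>R Q ((1 / \<sigma>) *\<^sub>R b)) \<bullet> ((1 / \<sigma>) *\<^sub>R b) = Q b \<bullet> b"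
    using \<sigma> by (simp add: linear_scale[OF Q] power2_eq_square)
  ultimately show "distr M borel (\<lambda>y. \<Sum>i<k. t i * ((g i \<bullet> y) / \<sigma>)) = normal_law 0 (\<Sum>i<k. (t i)\<^sup>2)"
    using form_orthonormal_sum[OF Q g(1), of t] by (simp add: b_def)
qed

text \<open>
  The exceptional null set depends on \<open>b\<close>; a countable dense set of \<open>b\<close> suffices, and this is where
  separability enters.
\<close>
lemma AE_all_functionals_imp_AE_zero:
  fixes v :: "'b \<Rightarrow> 'a::{real_inner, second_countable_topology}"
  assumes "\<And>b. AE y in M. b \<bullet> v y = 0"
  shows "AE y in M. v y = 0"
proof -
  obtain D :: "'a set" where D: "countable D" "\<And>X. open X \<Longrightarrow> X \<noteq> {} \<Longrightarrow> \<exists>d\<in>D. d \<in> X"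
    using countable_dense_setE by blast
  have "AE y in M. \<forall>b\<in>D. b \<bullet> v y = 0" using D(1) assms by (simp add: AE_ball_countable)
  then show ?thesis
  proof eventually_elim
    case (elim y)
    have "open {b. b \<bullet> v y \<noteq> 0}" by (intro open_Collect_neq continuous_intros)
    then have "{b. b \<bullet> v y \<noteq> 0} = {}" using D(2) elim by blast
    then have "v y \<bullet> v y = 0" by blast
    then show ?case by simp
  qed
qed

lemma AE_null_direction:
  assumes M: "gaussian_measure M \<zeta> C" and b: "b \<bullet> \<zeta> = 0" "C b = 0"
  shows "AE y in M. b \<bullet> y = 0"
proof -
  have sets: "sets M = sets borel" using M by (simp add: gaussian_measure_def)
  have m: "(\<lambda>y. b \<bullet> y) \<in> borel_measurable M"
    using borel_measurable_continuous_onI[of "\<lambda>y. b \<bullet> y"]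
    by (simp add: measurable_cong_sets[OF sets refl] continuous_intros)
  have "distr M borel (\<lambda>y. b \<bullet> y) = return borel 0"
    using M b by (simp add: gaussian_measure_def normal_law_def)
  then have "AE x in distr M borel (\<lambda>y. b \<bullet> y). x = 0"
    by (simp only:) (subst AE_return, auto)
  then show ?thesis by (subst (asm) AE_distr_iff[OF m]) auto
qed

text \<open>
  The hypotheses on \<open>D\<close> and \<open>Y\<close> make \<open>D\<close> positive, so the quotient is the genuine one.
\<close>
lemma statistic_le:
  fixes N D :: real
  assumes "N \<le> mu * s * X" "lam * s * Y \<le> D" "0 < mu" "0 < lam" "0 < s" "0 \<le> X" "0 < Y"
    and mn: "0 < m" "0 < n"
  shows "(real n * lam) / (real m * mu) * quotient_or c N D \<le> (X / real m) / (Y / real n)"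
proof -
  have D: "0 < lam * s * Y" using assms by simp
  then have Dpos: "0 < D" using assms(2) by linarith
  then have "quotient_or c N D = N / D" by (simp add: quotient_or_def)
  also have "\<dots> \<le> (mu * s * X) / D" using assms Dpos by (intro divide_right_mono) auto
  also have "\<dots> \<le> (mu * s * X) / (lam * s * Y)" using assms D Dpos by (intro divide_left_mono) auto
  finally have "(real n * lam) / (real m * mu) * quotient_or c N D
      \<le> (real n * lam) / (real m * mu) * ((mu * s * X) / (lam * s * Y))"
    using assms by (intro mult_left_mono) auto
  also have "\<dots> = (X / real m) / (Y / real n)" using assms by (simp add: field_simps)
  finally show ?thesis .
qed

section \<open>The level of the test\<close>

theorem theorem9p1:
  fixes U U\<^sub>0 :: "'a::{real_inner, polish_space} set"
    and Q :: "'a \<Rightarrow> 'a"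
    and P :: "'a \<times> real \<Rightarrow> 'a measure"
    and lam mu \<alpha> c :: real
    and m n :: nat
  assumes "subspace U" and "closed U"
    and "bounded_linear Q" and "nonneg_operator Q" and "self_adjoint Q" and "nuclear Q"
    and "invariant_under Q U" and "invariant_under Q (U\<^sup>\<bottom>)"
    and "\<And>\<zeta> \<sigma>. (\<zeta>, \<sigma>) \<in> U \<times> {0<..} \<Longrightarrow> gaussian_measure (P (\<zeta>, \<sigma>)) \<zeta> (\<lambda>x. \<sigma>\<^sup>2 *\<^sub>R Q x)"
    and "U\<^sub>0 \<subseteq> U" and "subspace U\<^sub>0" and "closed U\<^sub>0" and "U\<^sub>0 \<noteq> {0}" and "U\<^sub>0 \<noteq> U"
    and "invariant_under Q U\<^sub>0" and "invariant_under Q (U\<^sub>0\<^sup>\<bottom> \<inter> U)"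
    and "(\<lambda>x. Q (x - orth_proj U x)) \<noteq> (\<lambda>x. 0)"
    and "(\<lambda>x. Q (orth_proj U x - orth_proj U\<^sub>0 x)) \<noteq> (\<lambda>x. 0)"
    and "finite_dimensional (range (\<lambda>x. Q (orth_proj U x - orth_proj U\<^sub>0 x)))"
    and "lam = onorm (\<lambda>x. Q (x - orth_proj U x))"
    and "mu = onorm (\<lambda>x. Q (orth_proj U x - orth_proj U\<^sub>0 x))"
    and "n = dim {x. lam *\<^sub>R x - Q (x - orth_proj U x) = 0}"
    and "m = dim (range (\<lambda>x. Q (orth_proj U x - orth_proj U\<^sub>0 x)))"
    and "0 < \<alpha>" and "\<alpha> < 1"
  shows "level_of_significance P (U\<^sub>0 \<times> {0<..})
    (indicator {y. quantile (fisher m n) (1 - \<alpha>) \<le>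
        (real n * lam) / (real m * mu) *
        quotient_or c ((norm (orth_proj U y - orth_proj U\<^sub>0 y))\<^sup>2) ((norm (y - orth_proj U y))\<^sup>2)})
    \<alpha>"
proof -
  note U = assms(1,2) and U0 = assms(11,12) and U0U = assms(10) and Q = assms(3) and P = assms(9)
  interpret Q: bounded_linear Q by (rule Q)
  note linQ = Q.linear_axioms
  note saQ = assms(5) and nnQ = assms(4)
  have Qsym: "Q x \<bullet> y = x \<bullet> Q y" for x y using saQ by (simp add: self_adjoint_def)

  \<comment> \<open>\<open>D\<close> and \<open>R\<close> are the projections onto \<open>W\<close> and onto the orthogonal complement of \<open>U\<close>\<close>
  define W where "W = U\<^sub>0\<^sup>\<bottom> \<inter> U"
  define D where "D x = orth_proj U x - orth_proj U\<^sub>0 x" for x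
  define R where "R x = x - orth_proj U x" for x
  define A where "A x = Q (R x)" for x
  define B where "B x = Q (D x)" for x
  have lam: "lam = onorm A" and mu: "mu = onorm B"
    using assms(20,21) by (simp_all add: A_def[abs_def] B_def[abs_def] R_def D_def)
  have n: "n = dim {x. lam *\<^sub>R x - A x = 0}" and m: "m = dim (range B)"
    using assms(22,23) by (simp_all add: A_def[abs_def] B_def[abs_def] R_def D_def)
  have A0: "A \<noteq> (\<lambda>x. 0)" and B0: "B \<noteq> (\<lambda>x. 0)"
    using assms(17,18) by (simp_all add: A_def[abs_def] B_def[abs_def] R_def D_def)

  have W: "subspace W" unfolding W_def by (intro subspace_inter subspace_orthogonal_comp U)
  have U0_W: "u \<in> U\<^sub>0 \<Longrightarrow> w \<in> W \<Longrightarrow> w \<bullet> u = 0" for u w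
    by (auto simp: W_def orthogonal_comp_def orthogonal_def inner_commute)
  have U_perp: "u \<in> U \<Longrightarrow> v \<in> U\<^sup>\<bottom> \<Longrightarrow> v \<bullet> u = 0" for u v
    by (auto simp: orthogonal_comp_def orthogonal_def inner_commute)
  have WU: "w \<in> W \<Longrightarrow> w \<in> U" for w by (simp add: W_def)
  have D_in: "D x \<in> W" for x
  proof -
    have "u \<bullet> D x = 0" if "u \<in> U\<^sub>0" for u
      using that U0U by (simp add: D_def inner_diff_right inner_orth_proj[OF U] inner_orth_proj[OF U0] subset_iff)
    moreover have "D x \<in> U"
      using U0U orth_proj_in[OF U] orth_proj_in[OF U0] U(1) by (auto simp: D_def intro!: subspace_diff)
    ultimately show ?thesis by (auto simp: W_def orthogonal_comp_def orthogonal_def)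
  qed
  have inner_D: "w \<bullet> D x = w \<bullet> x" if "w \<in> W" for w x
    using that U0_W[OF orth_proj_in[OF U0]] by (simp add: D_def inner_diff_right inner_orth_proj[OF U] WU)
  have D_W: "D w = w" if "w \<in> W" for w
  proof -
    have "orth_proj U\<^sub>0 w = 0" using U0_W that by (intro orth_proj_eq_0[OF U0]) (simp add: inner_commute)
    then show ?thesis using that by (simp add: D_def orth_proj_id[OF U] WU)
  qed
  have R_in: "R x \<in> U\<^sup>\<bottom>" for x
    using orth_proj_residual[OF U] by (auto simp: R_def orthogonal_comp_def orthogonal_def)
  have R_perp: "R v = v" if "v \<in> U\<^sup>\<bottom>" for v
    using U_perp that by (simp add: R_def orth_proj_eq_0[OF U] inner_commute)
  have inner_R: "v \<bullet> R x = v \<bullet> x" if "v \<in> U\<^sup>\<bottom>" for v x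
    using U_perp[OF orth_proj_in[OF U] that] by (simp add: R_def inner_diff_right)
  have bl_D: "bounded_linear D" and bl_R: "bounded_linear R"
    unfolding D_def[abs_def] R_def[abs_def]
    by (intro bounded_linear_sub bounded_linear_ident bounded_linear_orth_proj U U0)+
  have bl_A: "bounded_linear A" and bl_B: "bounded_linear B"
    unfolding A_def[abs_def] B_def[abs_def] using bl_D bl_R Q by (auto intro: bounded_linear_compose)
  have norm_R: "norm (R x) \<le> norm x" for x
  proof -
    have "(norm (R x))\<^sup>2 = R x \<bullet> x" by (simp add: power2_norm_eq_inner inner_R R_in)
    also have "\<dots> \<le> norm (R x) * norm x" by (rule norm_cauchy_schwarz)
    finally show ?thesis by (cases "R x = 0") (auto simp: power2_eq_square)
  qed
  have Q_W: "Q w \<in> W" if "w \<in> W" for w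
    using assms(16) that by (auto simp: invariant_under_def W_def)
  have Q_perp: "Q v \<in> U\<^sup>\<bottom>" if "v \<in> U\<^sup>\<bottom>" for v
    using assms(8) that by (auto simp: invariant_under_def)
  have mu_pos: "0 < mu" unfolding mu using onorm_pos_lt[OF bl_B] B0 by auto
  have lam_pos: "0 < lam" unfolding lam using onorm_pos_lt[OF bl_A] A0 by auto

  define E where "E = {x. lam *\<^sub>R x - A x = 0}"
  have "linear (\<lambda>x. lam *\<^sub>R x - A x)"
    by (intro bounded_linear.linear bounded_linear_sub bounded_linear_scaleR_right bl_A)
  then have E: "subspace E" unfolding E_def by (rule linear_subspace_kernel)
  \<comment> \<open>as \<open>A\<close> maps into the orthogonal complement of \<open>U\<close>, its eigenvectors for \<open>lam > 0\<close> lie there, and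
      \<open>A\<close> agrees with \<open>Q\<close> on them\<close>
  have E_perp: "x \<in> U\<^sup>\<bottom>" and E_eigen: "Q x = lam *\<^sub>R x" if "x \<in> E" for x
  proof -
    have "lam *\<^sub>R x = A x" using that by (simp add: E_def)
    then have "(1 / lam) *\<^sub>R A x = (1 / lam) *\<^sub>R (lam *\<^sub>R x)" by simp
    also have "\<dots> = x" using lam_pos by simp
    finally have "x = (1 / lam) *\<^sub>R A x" by simp
    moreover have "A x \<in> U\<^sup>\<bottom>" by (simp add: A_def Q_perp R_in)
    ultimately show x: "x \<in> U\<^sup>\<bottom>" using subspace_scale[OF subspace_orthogonal_comp] by metis
    show "Q x = lam *\<^sub>R x" using that by (simp add: E_def A_def R_perp[OF x])
  qed
  have n_E: "n = dim E" by (simp only: n E_def)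
  obtain f where f: "form_orthonormal (\<lambda>x. x) n f" "\<And>i. i < n \<Longrightarrow> f i \<in> E"
    and f_expand: "\<And>w. w \<in> E \<Longrightarrow> w = (\<Sum>i<n. (f i \<bullet> w) *\<^sub>R f i)"
    unfolding n_E using nuclear_eigenspace_orthonormal_basis[OF assms(6) E E_eigen lam_pos] by blast
  \<comment> \<open>\<open>A\<close> inherits compactness from \<open>Q\<close>, so its norm is an eigenvalue and \<open>E\<close> is nontrivial\<close>
  have n_pos: "0 < n"
  proof (rule ccontr)
    assume "\<not> 0 < n"
    then have E_triv: "w = 0" if "w \<in> E" for w using f_expand[OF that] by simp
    have sym: "A x \<bullet> y = x \<bullet> A y" for x y
    proof -
      have "A x \<bullet> y = Q (R x) \<bullet> R y" by (simp add: A_def inner_R Q_perp R_in)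
      also have "\<dots> = Q (R y) \<bullet> R x" using Qsym[of "R x" "R y"] by (simp add: inner_commute)
      also have "\<dots> = x \<bullet> A y" by (simp add: A_def inner_R Q_perp R_in) (simp add: inner_commute)
      finally show ?thesis .
    qed
    have pos: "0 \<le> A x \<bullet> x" for x
      using nnQ inner_R[OF Q_perp[OF R_in[of x]], of x] unfolding A_def nonneg_operator_def by metis
    have img: "A ` cball 0 1 \<subseteq> closure (Q ` cball 0 1)"
      using norm_R closure_subset[of "Q ` cball 0 1"] by (force simp: A_def intro: order_trans)
    have "self_adjoint A" "nonneg_operator A"
      using sym pos by (simp_all add: self_adjoint_def nonneg_operator_def)
    then obtain z where "z \<noteq> 0" "A z = onorm A *\<^sub>R z"
      by (rule onorm_attained_as_eigenvalue[OF bl_A _ _ img nuclear_imp_compact[OF assms(6)] A0])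
    then show False using E_triv[of z] by (simp add: E_def lam)
  qed

  have range_B: "range B = Q ` W"
  proof (intro equalityI subsetI)
    fix y assume "y \<in> Q ` W"
    then obtain w where "w \<in> W" "y = Q w" by blast
    then have "y = B w" by (simp add: B_def D_W)
    then show "y \<in> range B" by simp
  qed (auto simp: B_def D_in)
  then have m_W: "m = dim (Q ` W)" by (simp add: m)
  have fin_QW: "finite_dimensional (Q ` W)"
    using assms(19) range_B by (simp add: B_def[abs_def] D_def)
  obtain g where g: "form_orthonormal Q m g" "\<And>i. i < m \<Longrightarrow> g i \<in> W"
    and g_null: "\<And>w. w \<in> W \<Longrightarrow> Q (w - (\<Sum>i<m. (Q (g i) \<bullet> w) *\<^sub>R g i)) = 0"
    unfolding m_W using finite_rank_form_orthonormal_basis[OF linQ saQ nnQ W fin_QW] by blast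
  have m_pos: "0 < m"
  proof (rule ccontr)
    assume "\<not> 0 < m"
    then have "B x = 0" for x using g_null[OF D_in[of x]] by (simp add: B_def)
    with B0 show False by auto
  qed

  \<comment> \<open>\<open>g\<close> lives in \<open>U\<close> and \<open>f\<close> in its orthogonal complement, both \<open>Q\<close>-invariant, so together they are
      \<open>Q\<close>-orthonormal once \<open>f\<close> is rescaled by the eigenvalue\<close>
  define h where "h i = (if i < m then g i else (1 / sqrt lam) *\<^sub>R f (i - m))" for i
  have h: "form_orthonormal Q (m + n) h"
    unfolding form_orthonormal_def
  proof (intro allI impI)
    fix i j assume ij: "i < m + n" "j < m + n"
    consider "i < m" "j < m" | "i < m" "m \<le> j" | "m \<le> i" "j < m" | "m \<le> i" "m \<le> j" by linarith
    then show "Q (h i) \<bullet> h j = (if i = j then 1 else 0)"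
    proof cases
      case 1 then show ?thesis using g(1) by (simp add: h_def form_orthonormal_def)
    next
      case 2
      then have "f (j - m) \<bullet> Q (g i) = 0"
        using ij by (intro U_perp E_perp f WU Q_W g) auto
      then show ?thesis using 2 by (simp add: h_def inner_commute)
    next
      case 3
      then have "f (i - m) \<bullet> g j = 0" "f (i - m) \<in> E"
        using ij by (auto intro!: U_perp E_perp f WU g)
      then show ?thesis using 3 by (simp add: h_def Q.scaleR E_eigen)
    next
      case 4
      then have "f (i - m) \<bullet> f (j - m) = (if i = j then 1 else 0)" "f (i - m) \<in> E"
        using f ij by (auto simp: form_orthonormal_def)
      then show ?thesis using 4 lam_pos by (simp add: h_def Q.scaleR E_eigen)
    qed
  qed

  \<comment> \<open>the numerator is at most, and the denominator at least, a sum of squares of Gaussian coordinates\<close>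
  have D_bound: "(norm (D y))\<^sup>2 \<le> mu * (\<Sum>i<m. (g i \<bullet> y)\<^sup>2)"
    if "D y = (\<Sum>i<m. (g i \<bullet> y) *\<^sub>R Q (g i))" for y
  proof -
    define w where "w = (\<Sum>i<m. (g i \<bullet> y) *\<^sub>R g i)"
    have wW: "w \<in> W" unfolding w_def using W g(2) by (intro subspace_sum subspace_scale) auto
    have "norm (Q (Q w)) \<le> mu * norm (Q w)"
      using onorm[OF bl_B, of "Q w"] by (simp add: B_def D_W Q_W wW mu)
    then have "(norm (Q w))\<^sup>2 \<le> mu * (Q w \<bullet> w)" by (rule nonneg_operator_norm_le[OF linQ saQ nnQ])
    moreover have "D y = Q w" using that by (simp add: w_def Q.sum Q.scaleR)
    moreover have "Q w \<bullet> w = (\<Sum>i<m. (g i \<bullet> y)\<^sup>2)"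
      unfolding w_def by (rule form_orthonormal_sum[OF linQ g(1)])
    ultimately show ?thesis by simp
  qed
  have R_bound: "(\<Sum>j<n. (f j \<bullet> y)\<^sup>2) \<le> (norm (R y))\<^sup>2" for y
  proof -
    have "(\<Sum>j<n. (f j \<bullet> y)\<^sup>2) = (\<Sum>j<n. (f j \<bullet> R y)\<^sup>2)"
      using f(2) E_perp inner_R by (intro sum.cong) auto
    also have "\<dots> \<le> (norm (R y))\<^sup>2" by (rule Bessel_inequality[OF f(1)])
    finally show ?thesis .
  qed

  define q where "q = quantile (fisher m n) (1 - \<alpha>)"
  define T where "T y = (real n * lam) / (real m * mu) * quotient_or c ((norm (D y))\<^sup>2) ((norm (R y))\<^sup>2)" for y
  define S where "S = {y. q \<le> T y}"
  have [measurable]: "D \<in> borel_measurable borel" "R \<in> borel_measurable borel"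
    using bl_D bl_R by (auto intro!: borel_measurable_continuous_onI linear_continuous_on)
  have [measurable]: "T \<in> borel_measurable borel"
    unfolding T_def quotient_or_def by measurable
  have S [measurable]: "S \<in> sets borel" unfolding S_def by measurable

  have level: "measure (P (\<zeta>, \<sigma>)) S \<le> \<alpha>" if \<zeta>: "\<zeta> \<in> U\<^sub>0" and \<sigma>: "0 < \<sigma>" for \<zeta> \<sigma>
  proof -
    let ?M = "P (\<zeta>, \<sigma>)"
    have M: "gaussian_measure ?M \<zeta> (\<lambda>x. \<sigma>\<^sup>2 *\<^sub>R Q x)" using P \<zeta> \<sigma> U0U by auto
    then interpret M: prob_space ?M by (simp add: gaussian_measure_def)
    have sets [measurable_cong]: "sets ?M = sets borel" using M by (simp add: gaussian_measure_def)
    have h_null: "h i \<bullet> \<zeta> = 0" if "i < m + n" for i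
      using that \<zeta> g(2) f(2) E_perp U_perp U0_W U0U by (auto simp: h_def subset_iff)
    define Z where "Z i y = (h i \<bullet> y) / \<sigma>" for i y
    have Z: "standard_gaussian_family ?M (m + n) Z"
      unfolding Z_def[abs_def] by (rule gaussian_measure_standard_family[OF M \<sigma> linQ h h_null])
    note Zm = standard_gaussian_familyD(2)[OF Z]
    define X Y where "X y = (\<Sum>i<m. (Z i y)\<^sup>2)" and "Y y = (\<Sum>j<n. (Z (m + j) y)\<^sup>2)" for y
    have [measurable]: "X \<in> borel_measurable ?M" "Y \<in> borel_measurable ?M"
      unfolding X_def Y_def using Zm by (auto intro!: borel_measurable_sum borel_measurable_power)
    have X_eq: "(\<Sum>i<m. (g i \<bullet> y)\<^sup>2) = \<sigma>\<^sup>2 * X y" for y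
      using \<sigma> by (simp add: X_def Z_def h_def sum_distrib_left power_divide)
    have Y_eq: "(\<Sum>j<n. (f j \<bullet> y)\<^sup>2) = lam * \<sigma>\<^sup>2 * Y y" for y
      using \<sigma> lam_pos by (simp add: Y_def Z_def h_def sum_distrib_left power_divide power_mult_distrib)
    \<comment> \<open>tested against any \<open>b\<close>, the difference is a functional \<open>w\<close> in \<open>W\<close> with \<open>Q w = 0\<close>, hence of
        variance zero\<close>
    have AE_D: "AE y in ?M. D y - (\<Sum>i<m. (g i \<bullet> y) *\<^sub>R Q (g i)) = 0"
    proof (rule AE_all_functionals_imp_AE_zero)
      fix b
      define w where "w = D b - (\<Sum>i<m. (Q (g i) \<bullet> D b) *\<^sub>R g i)"
      have wW: "w \<in> W" unfolding w_def using W g(2) D_in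
        by (intro subspace_diff subspace_sum subspace_scale) auto
      have "AE y in ?M. w \<bullet> y = 0"
        using AE_null_direction[OF M, of w] U0_W[OF \<zeta> wW] g_null[OF D_in] by (simp add: w_def)
      moreover have "b \<bullet> (D y - (\<Sum>i<m. (g i \<bullet> y) *\<^sub>R Q (g i))) = w \<bullet> y" for y
      proof -
        have "b \<bullet> D y = D b \<bullet> y" using inner_D[OF D_in, of b y] inner_D[OF D_in, of y b] by (simp add: inner_commute)
        moreover have "b \<bullet> Q (g i) = Q (g i) \<bullet> D b" if "i < m" for i
          using inner_D[OF Q_W[OF g(2)[OF that]]] by (simp add: inner_commute)
        ultimately show ?thesis
          by (simp add: w_def inner_diff_left inner_diff_right inner_sum_left inner_sum_right mult.commute)
      qed
      ultimately show "AE y in ?M. b \<bullet> (D y - (\<Sum>i<m. (g i \<bullet> y) *\<^sub>R Q (g i))) = 0" by simp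
    qed
    \<comment> \<open>one nonzero coordinate suffices for the sum of squares \<open>Y\<close> to be positive; \<open>Z m\<close> is the first of them\<close>
    have law: "distr ?M borel (Z m) = normal_law 0 1"
      using n_pos by (intro standard_gaussian_family_distr1[OF Z]) simp
    have "AE z in distr ?M borel (Z m). z \<noteq> 0" unfolding law by (rule AE_normal_law_neq)
    then have AE_Z: "AE y in ?M. Z m y \<noteq> 0"
      using Zm[of m] n_pos by (subst (asm) AE_distr_iff) auto
    have "AE y in ?M. y \<in> S \<longrightarrow> y \<in> {y \<in> space ?M. q \<le> (X y / real m) / (Y y / real n)}"
      using AE_D AE_Z AE_space
    proof eventually_elim
      case (elim y)
      have "(Z (m + 0) y)\<^sup>2 \<le> Y y"
        unfolding Y_def using n_pos by (intro member_le_sum) auto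
      then have "0 < Y y" using elim(2) by (smt (verit) add.right_neutral zero_less_power2)
      moreover have "0 \<le> X y" by (simp add: X_def sum_nonneg)
      moreover have "(norm (D y))\<^sup>2 \<le> mu * \<sigma>\<^sup>2 * X y"
        using D_bound[of y] elim(1) by (simp add: X_eq mult.assoc)
      moreover have "lam * \<sigma>\<^sup>2 * Y y \<le> (norm (R y))\<^sup>2"
        using R_bound[of y] by (simp add: Y_eq)
      ultimately have "T y \<le> (X y / real m) / (Y y / real n)"
        unfolding T_def using mu_pos lam_pos \<sigma> m_pos n_pos by (intro statistic_le[where s="\<sigma>\<^sup>2"]) auto
      then show ?case using elim(3) by (auto simp: S_def)
    qed
    then have "M.prob S \<le> M.prob {y \<in> space ?M. q \<le> (X y / real m) / (Y y / real n)}"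
      by (rule M.finite_measure_mono_AE) measurable
    also have "\<dots> = measure (distr ?M borel (\<lambda>y. (X y / real m) / (Y y / real n))) {q..}"
      by (subst measure_distr) (auto intro!: arg_cong[where f=M.prob])
    also have "distr ?M borel (\<lambda>y. (X y / real m) / (Y y / real n)) = fisher m n"
      unfolding X_def Y_def by (rule standard_gaussian_family_fisher[OF Z m_pos n_pos])
    also have "measure (fisher m n) {q..} \<le> \<alpha>"
      unfolding q_def using m_pos n_pos assms(24,25) by (rule fisher_quantile_tail)
    finally show ?thesis .
  qed

  have "level_of_significance P (U\<^sub>0 \<times> {0<..}) (indicator S) \<alpha>"
    unfolding level_of_significance_def statistical_test_def
  proof (intro conjI ballI)
    show "(indicator S :: 'a \<Rightarrow> real) \<in> borel_measurable borel" by measurable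
    fix \<theta> assume "\<theta> \<in> U\<^sub>0 \<times> {0::real<..}"
    then obtain \<zeta> \<sigma> where \<theta>: "\<theta> = (\<zeta>, \<sigma>)" "\<zeta> \<in> U\<^sub>0" "0 < \<sigma>" by auto
    have "gaussian_measure (P (\<zeta>, \<sigma>)) \<zeta> (\<lambda>x. \<sigma>\<^sup>2 *\<^sub>R Q x)" using P \<theta> U0U by auto
    then have "space (P (\<zeta>, \<sigma>)) = UNIV"
      using sets_eq_imp_space_eq[of "P (\<zeta>, \<sigma>)" borel] by (simp add: gaussian_measure_def)
    then show "(\<integral>y. indicator S y \<partial>P \<theta>) \<le> \<alpha>" using level[OF \<theta>(2,3)] by (simp add: \<theta>(1))
  qed (auto simp: indicator_def)
  then show ?thesis by (simp only: S_def q_def T_def D_def R_def)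
qed

end
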